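(* Let $K$ be a field, let $2<m\le n$ be integers, let $X=(x_{ij})$ be a generic $m\times n$ matrix of indeterminates and $R=K[X]$. If $\Delta$ is a closed hypergraph on $[n]$, then the generators of $J_\Delta$, i.e. the minors $[a_1\ldots a_k|b_1\ldots b_k]$ with $\{b_1,\dots,b_k\}\in\Delta$ and $\{a_1,\dots,a_k\}\subseteq[m]$, form a Gr\"obner basis of $J_\Delta$ with respect to $<_{\mathrm{lex}}$, and $J_\Delta$ is a radical ideal.
   Context: $[n]=\{1,\dots,n\}$. $[a_1\ldots a_k|b_1\ldots b_k]$ is the $k$-minor of $X$ with rows $a_1,\dots,a_k$ and columns $b_1,\dots,b_k$. The order $<_{\mathrm{lex}}$ is the lexicographic order on $R$ induced by $x_{11}>x_{12}>\cdots>x_{1n}>x_{21}>\cdots>x_{2n}>\cdots>x_{mn}$. A hypergraph $\Delta$ on $[n]$ is a family of subsets of $[n]$ (its hyperedges). Its determinantal hypergraph ideal is $J_\Delta=([a_1\ldots a_k|b_1\ldots b_k] : \{b_1,\dots,b_k\}\in\Delta,\ \{a_1,\dots,a_k\}\subseteq[m])$. A $k$-clique of $\Delta$ is a sub-hypergraph of $\Delta$ of the form $\Delta_{(k),T}=\{T'\subseteq T:|T'|=k\}$ for some $T\subseteq[n]$ (with $|T|\ge k$); it is maximal if it is not contained in another $k$-clique of $\Delta$. The clique decomposition of $\Delta$ is $\Delta=\Delta_1\cup\cdots\cup\Delta_r$, where $\Delta_1,\dots,\Delta_r$ are all the maximal cliques of $\Delta$ (for all values of $k$). $\Delta$ is closed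 if for all $i\ne j$, any generating minor of $J_{\Delta_i}$ and any generating minor of $J_{\Delta_j}$ have relatively prime initial terms with respect to $<_{\mathrm{lex}}$. *)

theory Defs
  imports
    "HOL-Library.Poly_Mapping"
    "HOL-Library.Product_Lexorder"
    "HOL-Algebra.Divisibility"
    "HOL-Algebra.Ideal"
    "Jordan_Normal_Form.Determinant"
begin

section \<open>The polynomial ring of a generic matrix\<close>

text \<open>
  The variable in row \<open>i\<close> and column \<open>j\<close> is the pair \<open>(i, j)\<close>, with indices starting at 1.
  A monomial is a finitely supported exponent vector. The type \<open>'k mpoly\<close> has a variable for every
  pair of natural numbers; the ring \<open>K[X]\<close> of the \<open>m \<times> n\<close> generic matrix is the subring
  of those polynomials in which only the variables from \<open>{1..m} \<times> {1..n}\<close> occur.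
\<close>

type_synonym monom = "(nat \<times> nat) \<Rightarrow>\<^sub>0 nat"
type_synonym 'k mpoly = "monom \<Rightarrow>\<^sub>0 'k"

definition KX :: "nat \<Rightarrow> nat \<Rightarrow> 'k::field mpoly ring" where
  "KX m n =
     \<lparr>carrier = {p. \<forall>s \<in> Poly_Mapping.keys p. Poly_Mapping.keys s \<subseteq> {1..m} \<times> {1..n}},
      mult = (*), one = 1, zero = 0, add = (+)\<rparr>"

definition var :: "nat \<Rightarrow> nat \<Rightarrow> 'k::field mpoly" where
  "var i j = Poly_Mapping.single (Poly_Mapping.single (i, j) 1) 1"

text \<open>
  The order on monomials is the one of \<^theory>\<open>HOL-Library.Poly_Mapping\<close>, which compares two
  monomials at the least variable where their exponents differ. With the lexicographic order on
  index pairs, this is the lexicographic order induced by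
  \<open>x\<^sub>1\<^sub>1 > x\<^sub>1\<^sub>2 > \<dots> > x\<^sub>1\<^sub>n > x\<^sub>2\<^sub>1 > \<dots> > x\<^sub>m\<^sub>n\<close>: a smaller index pair is a larger variable.
\<close>

lemma monom_less_iff:
  fixes s t :: monom
  shows "s < t \<longleftrightarrow>
    (\<exists>i j. Poly_Mapping.lookup s (i, j) < Poly_Mapping.lookup t (i, j) \<and>
       (\<forall>i' j'. i' < i \<or> i' = i \<and> j' < j \<longrightarrow>
          Poly_Mapping.lookup s (i', j') = Poly_Mapping.lookup t (i', j')))"
  by (simp add: less_poly_mapping.rep_eq less_fun_def less_prod_def')

text \<open>For \<open>f = 0\<close> the coefficient read off is 0, so the initial term of 0 is 0.\<close>

definition initial_term :: "'k::field mpoly \<Rightarrow> 'k mpoly" where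
  "initial_term f =
     (let s = Max (Poly_Mapping.keys f) in Poly_Mapping.single s (Poly_Mapping.lookup f s))"

lemma initial_term_zero [simp]: "initial_term 0 = 0"
  by (simp add: initial_term_def Let_def)

definition relatively_prime :: "('a, 'b) ring_scheme \<Rightarrow> 'a \<Rightarrow> 'a \<Rightarrow> bool" where
  "relatively_prime R f g \<longleftrightarrow>
     (\<forall>d \<in> carrier R. d divides\<^bsub>R\<^esub> f \<and> d divides\<^bsub>R\<^esub> g \<longrightarrow> d \<in> Units R)"

definition groebner_basis :: "nat \<Rightarrow> nat \<Rightarrow> 'k::field mpoly set \<Rightarrow> 'k mpoly set \<Rightarrow> bool" where
  "groebner_basis m n G I \<longleftrightarrow> finite G \<and> G \<subseteq> I \<and>
     Idl\<^bsub>KX m n\<^esub> (initial_term ` I) = Idl\<^bsub>KX m n\<^esub> (initial_term ` G)"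

definition radical :: "('a, 'b) ring_scheme \<Rightarrow> 'a set \<Rightarrow> 'a set" where
  "radical R I = {a \<in> carrier R. \<exists>k::nat. 0 < k \<and> a [^]\<^bsub>R\<^esub> k \<in> I}"


section \<open>Determinantal hypergraph ideals\<close>

text \<open>
  The minor \<open>[a\<^sub>1\<dots>a\<^sub>k|b\<^sub>1\<dots>b\<^sub>k]\<close> is given by its set \<open>A\<close> of rows and its set \<open>B\<close> of columns, both
  listed increasingly; it is used only for \<open>card A = card B\<close>. The minor with \<open>k = 0\<close> is 1.
\<close>

definition minor :: "nat set \<Rightarrow> nat set \<Rightarrow> 'k::field mpoly" where
  "minor A B =
     det (mat (card A) (card B)
       (\<lambda>(p, q). var (sorted_list_of_set A ! p) (sorted_list_of_set B ! q)))"

definition hypergraph :: "nat \<Rightarrow> nat set set \<Rightarrow> bool" where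
  "hypergraph n \<Delta> \<longleftrightarrow> \<Delta> \<subseteq> Pow {1..n}"

definition generating_minors :: "nat \<Rightarrow> nat set set \<Rightarrow> 'k::field mpoly set" where
  "generating_minors m \<Delta> = {minor A B | A B. B \<in> \<Delta> \<and> A \<subseteq> {1..m} \<and> card A = card B}"

definition hypergraph_ideal :: "nat \<Rightarrow> nat \<Rightarrow> nat set set \<Rightarrow> 'k::field mpoly set" where
  "hypergraph_ideal m n \<Delta> = Idl\<^bsub>KX m n\<^esub> (generating_minors m \<Delta>)"

definition is_clique :: "nat \<Rightarrow> nat set set \<Rightarrow> nat \<Rightarrow> nat set set \<Rightarrow> bool" where
  "is_clique n \<Delta> k C \<longleftrightarrow>
     C \<subseteq> \<Delta> \<and> (\<exists>T \<subseteq> {1..n}. k \<le> card T \<and> C = {T'. T' \<subseteq> T \<and> card T' = k})"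

definition is_maximal_clique :: "nat \<Rightarrow> nat set set \<Rightarrow> nat \<Rightarrow> nat set set \<Rightarrow> bool" where
  "is_maximal_clique n \<Delta> k C \<longleftrightarrow>
     is_clique n \<Delta> k C \<and> \<not> (\<exists>C'. is_clique n \<Delta> k C' \<and> C' \<noteq> C \<and> C \<subseteq> C')"

definition clique_decomposition :: "nat \<Rightarrow> nat set set \<Rightarrow> nat set set set" where
  "clique_decomposition n \<Delta> = {C. \<exists>k. is_maximal_clique n \<Delta> k C}"

text \<open>The type argument is the coefficient field, over which the minors are formed.\<close>

definition closed_hypergraph ::
  "'k::field itself \<Rightarrow> nat \<Rightarrow> nat \<Rightarrow> nat set set \<Rightarrow> bool" where
  "closed_hypergraph _ m n \<Delta> \<longleftrightarrow>
     (\<forall>C \<in> clique_decomposition n \<Delta>. \<forall>C' \<in> clique_decomposition n \<Delta>. C \<noteq> C' \<longrightarrow>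
        (\<forall>f \<in> generating_minors m C. \<forall>g \<in> generating_minors m C'.
           relatively_prime (KX m n) (initial_term (f :: 'k mpoly)) (initial_term g)))"


section \<open>Consistency of the definitions\<close>

lemma KX_simps [simp]:
  "mult (KX m n) = (*)" "one (KX m n) = 1" "zero (KX m n) = 0" "add (KX m n) = (+)"
  by (simp_all add: KX_def)

lemma KX_carrier_iff:
  "p \<in> carrier (KX m n) \<longleftrightarrow>
     (\<forall>s \<in> Poly_Mapping.keys p. Poly_Mapping.keys s \<subseteq> {1..m} \<times> {1..n})"
  by (simp add: KX_def)

lemma KX_closed:
  fixes p q :: "'k::field mpoly"
  assumes p: "p \<in> carrier (KX m n)" and q: "q \<in> carrier (KX m n)"
  shows "p + q \<in> carrier (KX m n)" "p * q \<in> carrier (KX m n)" "- p \<in> carrier (KX m n)"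
proof -
  show "p + q \<in> carrier (KX m n)"
    using p q Poly_Mapping.keys_add[of p q] unfolding KX_carrier_iff by blast
  show "- p \<in> carrier (KX m n)"
    using p unfolding KX_carrier_iff by simp
  show "p * q \<in> carrier (KX m n)"
    unfolding KX_carrier_iff
  proof
    fix s assume "s \<in> Poly_Mapping.keys (p * q)"
    then obtain a b where ab: "s = a + b" "a \<in> Poly_Mapping.keys p" "b \<in> Poly_Mapping.keys q"
      using keys_mult[of p q] by blast
    have "Poly_Mapping.keys s \<subseteq> Poly_Mapping.keys a \<union> Poly_Mapping.keys b"
      using ab(1) Poly_Mapping.keys_add[of a b] by simp
    then show "Poly_Mapping.keys s \<subseteq> {1..m} \<times> {1..n}"
      using p q ab unfolding KX_carrier_iff by blast
  qed
qed

lemma KX_zero_one [simp]: "0 \<in> carrier (KX m n)" "1 \<in> carrier (KX m n)"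
  by (auto simp: KX_carrier_iff)

lemma cring_KX: "cring (KX m n :: 'k::field mpoly ring)"
proof (rule cringI)
  show "abelian_group (KX m n :: 'k mpoly ring)"
  proof (rule abelian_groupI; simp add: KX_closed add.assoc add.commute)
    fix x :: "'k mpoly" assume "x \<in> carrier (KX m n)"
    then show "\<exists>y \<in> carrier (KX m n). x + y = 0"
      using KX_closed(3)[of x m n x] by (intro bexI[of _ "- x"]) auto
  qed
  show "comm_monoid (KX m n :: 'k mpoly ring)"
    by (rule comm_monoidI) (simp_all add: KX_closed mult.assoc mult.commute)
qed (simp add: distrib_right)

lemma var_in_KX:
  assumes "i \<in> {1..m}" "j \<in> {1..n}"
  shows "var i j \<in> carrier (KX m n)"
  using assms by (simp add: var_def KX_carrier_iff)

lemma KX_prod_closed: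
  assumes "\<And>i. i \<in> S \<Longrightarrow> f i \<in> carrier (KX m n)"
  shows "prod f S \<in> carrier (KX m n)"
  using assms by (induction S rule: infinite_finite_induct) (simp_all add: KX_closed)

lemma KX_sum_closed:
  assumes "\<And>i. i \<in> S \<Longrightarrow> f i \<in> carrier (KX m n)"
  shows "sum f S \<in> carrier (KX m n)"
  using assms by (induction S rule: infinite_finite_induct) (simp_all add: KX_closed)

lemma minor_in_KX:
  assumes A: "A \<subseteq> {1..m}" and B: "B \<subseteq> {1..n}" and c: "card A = card B"
  shows "(minor A B :: 'k::field mpoly) \<in> carrier (KX m n)"
proof -
  have fin: "finite A" "finite B"
    using A B finite_subset by blast+
  have v: "var (sorted_list_of_set A ! i) (sorted_list_of_set B ! j) \<in> carrier (KX m n)"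
    if "i < card A" "j < card B" for i j
  proof (rule var_in_KX)
    show "sorted_list_of_set A ! i \<in> {1..m}"
      using nth_mem[of i "sorted_list_of_set A"] that fin A by auto
    show "sorted_list_of_set B ! j \<in> {1..n}"
      using nth_mem[of j "sorted_list_of_set B"] that fin B by auto
  qed
  let ?k = "card B"
  let ?f = "\<lambda>(p, q). var (sorted_list_of_set A ! p) (sorted_list_of_set B ! q) :: 'k mpoly"
  have "signof p * (\<Prod>i = 0..<?k. mat ?k ?k ?f $$ (i, p i)) \<in> carrier (KX m n)"
    if p: "p permutes {0..<?k}" for p
  proof (rule KX_closed(2))
    show "(signof p :: 'k mpoly) \<in> carrier (KX m n)"
      using KX_closed(3)[of "1 :: 'k mpoly" m n 1] by (simp add: sign_def)
    show "(\<Prod>i = 0..<?k. mat ?k ?k ?f $$ (i, p i)) \<in> carrier (KX m n)"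
    proof (rule KX_prod_closed)
      fix i assume i: "i \<in> {0..<?k}"
      then have "p i \<in> {0..<?k}"
        using permutes_in_image[OF p] by blast
      with i show "mat ?k ?k ?f $$ (i, p i) \<in> carrier (KX m n)"
        using v[of i "p i"] c by simp
    qed
  qed
  then show ?thesis
    unfolding minor_def det_def c dim_row_mat dim_col_mat by (auto intro!: KX_sum_closed)
qed

lemma generating_minors_in_KX:
  "hypergraph n \<Delta> \<Longrightarrow> generating_minors m \<Delta> \<subseteq> carrier (KX m n)"
  unfolding generating_minors_def hypergraph_def by (blast intro: minor_in_KX)

lemma hypergraph_ideal_is_ideal:
  "hypergraph n \<Delta> \<Longrightarrow> ideal (hypergraph_ideal m n \<Delta> :: 'k::field mpoly set) (KX m n)"
  unfolding hypergraph_ideal_def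
  by (intro ring.genideal_ideal cring.axioms(1) cring_KX generating_minors_in_KX)

lemma Union_clique_decomposition:
  assumes "hypergraph n \<Delta>"
  shows "\<Union> (clique_decomposition n \<Delta>) = \<Delta>"
proof
  show "\<Union> (clique_decomposition n \<Delta>) \<subseteq> \<Delta>"
    by (auto simp: clique_decomposition_def is_maximal_clique_def is_clique_def)
  show "\<Delta> \<subseteq> \<Union> (clique_decomposition n \<Delta>)"
  proof
    fix B assume B: "B \<in> \<Delta>"
    let ?S = "{C. is_clique n \<Delta> (card B) C}"
    have Bn: "B \<subseteq> {1..n}"
      using assms B by (auto simp: hypergraph_def)
    then have finB: "finite B"
      using finite_subset by blast
    have "{T'. T' \<subseteq> B \<and> card T' = card B} = {B}"
      using finB by (auto dest: card_subset_eq)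
    then have single: "{B} \<in> ?S"
      using B Bn by (auto simp: is_clique_def intro!: exI[of _ B])
    have "?S \<subseteq> Pow (Pow {1..n})"
      using assms by (auto simp: is_clique_def hypergraph_def)
    then have "finite ?S"
      by (rule finite_subset) simp
    then obtain M where M: "M \<in> ?S" "{B} \<subseteq> M" "\<forall>C \<in> ?S. M \<subseteq> C \<longrightarrow> M = C"
      using finite_has_maximal2[OF _ single] by metis
    then have "M \<in> clique_decomposition n \<Delta>"
      by (auto simp: clique_decomposition_def is_maximal_clique_def)
    then show "B \<in> \<Union> (clique_decomposition n \<Delta>)"
      using M(2) by blast
  qed
qed

end

theory Submission
  imports Defs "HOL-Computational_Algebra.Fraction_Field"
begin

text \<open>
  The initial monomial of a minor is its diagonal, a squarefree monomial whose variables form a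
  chain: both indices increase strictly. Everything therefore follows from one statement about
  leading monomials: every nonzero \<open>f\<close> in \<open>J\<^sub>\<Delta>\<close> has a leading monomial divisible by the diagonal of
  a generating minor. This is the Groebner basis property
  (\<open>lm_covers_imp_groebner_basis\<close>), and squarefreeness of the diagonals makes \<open>J\<^sub>\<Delta>\<close> radical: if
  \<open>f ^ e \<in> J\<^sub>\<Delta>\<close>, a squarefree diagonal that divides the \<open>e\<close>-th power of the leading
  monomial of \<open>f\<close> divides the leading monomial itself, so the leading term of \<open>f\<close> can be cancelled
  without leaving the radical (\<open>squarefree_lm_imp_radical\<close>).

  One clique, with vertex set \<open>T\<close> and \<open>k = r + 1\<close>, is the classical theorem on the minors of a
  generic matrix (\<open>lm_covers_clique\<close>). An element \<open>f\<close> of the ideal vanishes at every matrix, over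
  any field extension, whose columns in \<open>T\<close> have rank at most \<open>r\<close>. Over an infinite field this
  forces a chain of \<open>r + 1\<close> variables with columns in \<open>T\<close> in \<open>lm f\<close>. To see this, the entries are
  removed one at a time in reading order, which is the order of the variables. Removing an entry
  replaces \<open>f\<close> by its leading coefficient in that variable, and this coefficient vanishes under
  rank bounds on the remaining south-east blocks. The bound for a block is \<open>r\<close> minus the length of
  the longest chain in \<open>lm f\<close> strictly north-west of it, so a bound drops only where a chain grows
  (\<open>front_step\<close>). If no chain had more than \<open>r\<close> elements, the bounds would stay nonnegative and the
  zero matrix would satisfy all of them at the end, although what remains then is the nonzero
  leading coefficient of \<open>f\<close>. The induction step uses two facts. If the block south-east of the
  entry has rank below its bound, the entry may be sent to infinity while that block is corrected by
  an outer product, so that the Schur complement stays the same (\<open>front_limit\<close>,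
  \<open>rank_le_pivot\<close>). Otherwise the entry can be chosen so that the rank does not grow
  (\<open>rank_le_fill_corner\<close>).

  Cliques are combined as in Buchberger's criterion (\<open>lm_covers_of_pairs\<close>): it suffices to rewrite
  the difference of two monomial multiples of generators with equal leading monomials by multiples
  with smaller ones. For two generators from the same clique this is division by the Groebner basis
  of that clique (\<open>clique_pair\<close>); for generators from different cliques the initial terms are
  relatively prime, and the tails of the two generators give the rewriting (\<open>coprime_pair\<close>).
\<close>

section \<open>Leading monomials\<close>

abbreviation "keys \<equiv> Poly_Mapping.keys"
abbreviation "lookup \<equiv> Poly_Mapping.lookup"
abbreviation "single \<equiv> Poly_Mapping.single"

definition lm :: "'k::field mpoly \<Rightarrow> monom" where "lm f = Max (keys f)"

lemma lookup_single_times: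
  fixes f :: "'k::field mpoly"
  shows "lookup (single a c * f) (a + t) = c * lookup f t"
proof -
  have "lookup (single a c * f) (a + t)
      = (\<Sum>l. lookup (single a c) l * (\<Sum>q. lookup f q when a + t = l + q))"
    by (simp add: lookup_mult)
  also have "\<dots> = (\<Sum>l. c * (\<Sum>q. lookup f q when a + t = l + q) when l = a)"
    by (rule Sum_any.cong) (auto simp: lookup_single when_def)
  also have "\<dots> = c * lookup f t"
    by simp
  finally show ?thesis .
qed

lemma keys_single_times:
  fixes f :: "'k::field mpoly"
  shows "keys (single a c * f) = (if c = 0 then {} else (+) a ` keys f)"
proof (cases "c = 0")
  case False
  have "s \<in> keys (single a c * f) \<longleftrightarrow> s \<in> (+) a ` keys f" for s
  proof
    assume "s \<in> keys (single a c * f)"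
    then show "s \<in> (+) a ` keys f"
      using keys_mult[of "single a c" f] False by auto
  next
    assume "s \<in> (+) a ` keys f"
    then show "s \<in> keys (single a c * f)"
      using False by (auto simp: in_keys_iff lookup_single_times)
  qed
  with False show ?thesis by auto
qed simp

lemma lm_in_keys: "f \<noteq> 0 \<Longrightarrow> lm f \<in> keys f"
  by (simp add: lm_def)

lemma lm_ge: "t \<in> keys f \<Longrightarrow> t \<le> lm f"
  by (simp add: lm_def)

lemma lm_unique: "t \<in> keys f \<Longrightarrow> (\<And>u. u \<in> keys f \<Longrightarrow> u \<le> t) \<Longrightarrow> lm f = t"
  by (simp add: lm_def Max_eqI)

text \<open>
  The two extreme monomials contribute the only summand of the convolution at the top exponent,
  and it is nonzero because a field has no zero divisors.
\<close>

lemma lm_times: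
  fixes f g :: "'k::field mpoly"
  assumes "f \<noteq> 0" "g \<noteq> 0"
  shows "lm (f * g) = lm f + lm g"
proof (rule lm_unique)
  show "u \<le> lm f + lm g" if "u \<in> keys (f * g)" for u
    using that keys_mult[of f g] lm_ge by (fastforce intro: add_mono)
  have "lookup (f * g) (lm f + lm g)
      = (\<Sum>l. lookup f l * (\<Sum>q. lookup g q when lm f + lm g = l + q))"
    by (simp add: lookup_mult)
  also have "\<dots> = (\<Sum>l. lookup f l * lookup g (lm g) when l = lm f)"
  proof (rule Sum_any.cong)
    fix l
    have "lookup f l * (\<Sum>q. lookup g q when lm f + lm g = l + q) = 0" if "l \<noteq> lm f"
    proof (cases "l \<in> keys f")
      case True
      then have "l < lm f" using that lm_ge[of l f] by simp
      then have "(lookup g q when lm f + lm g = l + q) = 0" for q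
        using lm_ge[of q g] add_less_le_mono[of l "lm f" q "lm g"]
        by (cases "q \<in> keys g") (auto simp: when_def in_keys_iff)
      then show ?thesis by simp
    qed (simp add: in_keys_iff)
    then show "lookup f l * (\<Sum>q. lookup g q when lm f + lm g = l + q)
        = (lookup f l * lookup g (lm g) when l = lm f)"
      by (auto simp: when_def)
  qed
  also have "\<dots> = lookup f (lm f) * lookup g (lm g)" by simp
  also have "\<dots> \<noteq> 0"
    using lm_in_keys[OF assms(1)] lm_in_keys[OF assms(2)] by (simp add: in_keys_iff)
  finally show "lm f + lm g \<in> keys (f * g)" by (simp add: in_keys_iff)
qed

lemma lm_power:
  fixes f :: "'k::field mpoly"
  assumes "f \<noteq> 0"
  shows "f ^ e \<noteq> 0 \<and> lookup (lm (f ^ e)) x = e * lookup (lm f) x"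
proof (induction e)
  case 0
  have "lm (1 :: 'k mpoly) = 0" by (simp add: lm_def)
  then show ?case by simp
next
  case (Suc e)
  then show ?case using assms by (simp add: lm_times lookup_add)
qed

text \<open>
  With finitely many variables the order is the lexicographic order on exponent vectors of fixed
  length. With all variables it is not well-founded, as the variables themselves descend forever.
\<close>

lemma wf_monom:
  assumes "finite X"
  shows "wf {(s, t :: monom). s < t \<and> keys s \<subseteq> X \<and> keys t \<subseteq> X}"
proof -
  define xs where "xs = sorted_list_of_set X"
  have xs: "set xs = X" "sorted_wrt (<) xs"
    using assms by (simp_all add: xs_def)
  let ?h = "\<lambda>s :: monom. map (lookup s) xs"
  have "(?h s, ?h t) \<in> lex less_than" if st: "s < t" "keys s \<subseteq> X" "keys t \<subseteq> X" for s t
  proof -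
    obtain x where x: "lookup s x < lookup t x" "\<And>y. y < x \<Longrightarrow> lookup s y = lookup t y"
      using st(1) unfolding less_poly_mapping.rep_eq less_fun_def by blast
    have "x \<in> keys t" using x(1) by (auto simp: in_keys_iff)
    then obtain ys zs where yz: "xs = ys @ x # zs"
      using xs(1) st(3) by (meson subsetD split_list)
    have "map (lookup s) ys = map (lookup t) ys"
      using xs(2) x(2) by (auto simp: yz sorted_wrt_append)
    then show ?thesis
      unfolding lex_conv using x(1)
      by (auto simp: yz intro!: exI[of _ "map (lookup t) ys"])
  qed
  then have "{(s, t). s < t \<and> keys s \<subseteq> X \<and> keys t \<subseteq> X} \<subseteq> inv_image (lex less_than) ?h"
    by auto
  then show ?thesis
    using wf_subset wf_inv_image[OF wf_lex[OF wf_less_than]] by blast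
qed

section \<open>Spans of monomial multiples and division with remainder\<close>

text \<open>
  The \<open>K\<close>-span of the multiples \<open>x\<^sup>a g\<close> with \<open>g \<in> G\<close>, with \<open>a\<close> a monomial in the variables \<open>X\<close>, whose
  leading exponent \<open>a + lm g\<close> satisfies \<open>P\<close>. With \<open>P\<close> a strict or weak upper bound this expresses that
  a polynomial has a representation without cancellation above that bound.
\<close>

inductive_set mspan :: "(nat \<times> nat) set \<Rightarrow> 'k::field mpoly set \<Rightarrow> (monom \<Rightarrow> bool) \<Rightarrow> 'k mpoly set"
  for X G P where
  mspan_zero: "0 \<in> mspan X G P"
| mspan_step: "p \<in> mspan X G P \<Longrightarrow> g \<in> G \<Longrightarrow> keys a \<subseteq> X \<Longrightarrow> P (a + lm g) \<Longrightarrow>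
    p + single a c * g \<in> mspan X G P"

lemma mspan_one:
  "g \<in> G \<Longrightarrow> keys a \<subseteq> X \<Longrightarrow> P (a + lm g) \<Longrightarrow> single a c * g \<in> mspan X G P"
  using mspan_step[OF mspan_zero] by force

lemma mspan_add: "q \<in> mspan X G P \<Longrightarrow> p \<in> mspan X G P \<Longrightarrow> p + q \<in> mspan X G P"
  by (induction rule: mspan.induct) (auto simp: add.assoc[symmetric] intro: mspan.intros)

lemma mspan_mono:
  "p \<in> mspan X G P \<Longrightarrow> G \<subseteq> H \<Longrightarrow> (\<And>s. P s \<Longrightarrow> Q s) \<Longrightarrow> p \<in> mspan X H Q"
  by (induction rule: mspan.induct) (auto intro: mspan.intros)

lemma mspan_shift:
  assumes "p \<in> mspan X G P" "keys b \<subseteq> X" "\<And>s. P s \<Longrightarrow> Q (b + s)"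
  shows "single b d * p \<in> mspan X G Q"
  using assms(1)
proof (induction rule: mspan.induct)
  case (mspan_step p g a c)
  have "keys (b + a) \<subseteq> X"
    using mspan_step.hyps assms(2) keys_add[of b a] by blast
  moreover have "Q (b + a + lm g)"
    using assms(3)[OF mspan_step.hyps(4)] by (simp add: add.assoc)
  ultimately have "single b d * p + single (b + a) (d * c) * g \<in> mspan X G Q"
    using mspan_step by (blast intro: mspan.mspan_step)
  then show ?case
    by (simp add: distrib_left mult_single mult.assoc[symmetric])
qed (simp add: mspan_zero)

lemma mspan_scale: "p \<in> mspan X G P \<Longrightarrow> single 0 d * p \<in> mspan X G P"
  by (rule mspan_shift) auto

lemma mspan_diff: "q \<in> mspan X G P \<Longrightarrow> p \<in> mspan X G P \<Longrightarrow> p - q \<in> mspan X G P"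
  using mspan_add[of "single 0 (-1) * q" X G P p] mspan_scale[of q X G P "-1"]
  by (simp add: single_uminus)

lemma mspan_sum: "(\<And>i. i \<in> I \<Longrightarrow> f i \<in> mspan X G P) \<Longrightarrow> sum f I \<in> mspan X G P"
  by (induction I rule: infinite_finite_induct) (auto intro: mspan.intros mspan_add)

lemma poly_mapping_sum_single: "f = (\<Sum>t \<in> keys f. single t (lookup f t))"
  by (rule poly_mapping_eqI)
     (simp add: lookup_sum lookup_single when_def in_keys_iff)

lemma mspan_mult:
  fixes p h :: "'k::field mpoly"
  assumes "p \<in> mspan X G P" "\<And>b. b \<in> keys h \<Longrightarrow> keys b \<subseteq> X"
    "\<And>b s. b \<in> keys h \<Longrightarrow> P s \<Longrightarrow> Q (b + s)"
  shows "h * p \<in> mspan X G Q"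
proof -
  have "h * p = (\<Sum>b \<in> keys h. single b (lookup h b) * p)"
    by (subst poly_mapping_sum_single[of h]) (simp add: sum_distrib_right)
  also have "\<dots> \<in> mspan X G Q"
    by (rule mspan_sum, rule mspan_shift[OF assms(1)]) (use assms(2,3) in blast)+
  finally show ?thesis .
qed

lemma keys_rep:
  assumes "p \<in> mspan X G (\<lambda>s. s < u)" "t \<in> keys p"
  shows "t < u"
  using assms
proof (induction arbitrary: t rule: mspan.induct)
  case (mspan_step p g a c)
  from mspan_step.prems consider "t \<in> keys p" | "t \<in> keys (single a c * g)"
    using keys_add[of p "single a c * g"] by blast
  then show ?case
  proof cases
    case 2
    then obtain v where "t = a + v" "v \<in> keys g"
      by (auto simp: keys_single_times split: if_splits)
    then have "t \<le> a + lm g" by (simp add: lm_ge add_left_mono)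
    with mspan_step.hyps(4) show ?thesis by simp
  qed (rule mspan_step.IH)
qed simp

lemma Idl_subset_rep:
  fixes G :: "'k::field mpoly set"
  assumes "G \<subseteq> carrier (KX m n)"
  shows "Idl\<^bsub>KX m n\<^esub> G \<subseteq> mspan ({1..m} \<times> {1..n}) G (\<lambda>_. True)" (is "_ \<subseteq> ?R")
proof -
  interpret cring "KX m n :: 'k mpoly ring" by (rule cring_KX)
  have closed: "p \<in> carrier (KX m n)" if "p \<in> ?R" for p
    using that
  proof (induction rule: mspan.induct)
    case (mspan_step p g a c)
    have "single a c \<in> carrier (KX m n)"
      using mspan_step.hyps by (auto simp: KX_carrier_iff)
    then show ?case using mspan_step assms by (auto intro: KX_closed)
  qed simp
  have mult: "h * p \<in> ?R" if "p \<in> ?R" "h \<in> carrier (KX m n)" for h p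
    by (rule mspan_mult[OF that(1)]) (use that(2) in \<open>auto simp: KX_carrier_iff\<close>)
  have minus: "\<ominus>\<^bsub>KX m n\<^esub> p = - p" if "p \<in> carrier (KX m n)" for p :: "'k mpoly"
    using that by (intro minus_equality) (auto intro: KX_closed)
  have "ideal ?R (KX m n)"
  proof (rule idealI[OF ring_axioms])
    show "subgroup ?R (add_monoid (KX m n))"
    proof (rule subgroup.intro)
      show "inv\<^bsub>add_monoid (KX m n)\<^esub> x \<in> ?R" if "x \<in> ?R" for x
        using that minus[OF closed[OF that]] mspan_diff[OF that mspan_zero]
        by (simp add: a_inv_def)
    qed (use closed in \<open>auto intro: mspan_add mspan_zero\<close>)
    show "x \<otimes>\<^bsub>KX m n\<^esub> a \<in> ?R" "a \<otimes>\<^bsub>KX m n\<^esub> x \<in> ?R"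
      if "a \<in> ?R" "x \<in> carrier (KX m n)" for a x
      using mult[OF that] by (simp_all add: mult.commute)
  qed
  moreover have "G \<subseteq> ?R"
    using mspan_one[of _ G 0 "{1..m} \<times> {1..n}" "\<lambda>_. True" 1] by fastforce
  ultimately show ?thesis by (rule genideal_minimal)
qed

lemma mspan_subset_ideal:
  fixes G I :: "'k::field mpoly set"
  assumes I: "ideal I (KX m n)" and "G \<subseteq> I" and p: "p \<in> mspan ({1..m} \<times> {1..n}) G P"
  shows "p \<in> I"
  using p
proof (induction rule: mspan.induct)
  case mspan_zero
  show ?case using additive_subgroup.zero_closed[OF ideal.axioms(1)[OF I]] by simp
next
  case (mspan_step p g a c)
  have "single a c \<in> carrier (KX m n)"
    using mspan_step.hyps by (auto simp: KX_carrier_iff)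
  then have "single a c * g \<in> I"
    using ideal.I_l_closed[OF I, of g] mspan_step.hyps assms(2) by auto
  then show ?case
    using additive_subgroup.a_closed[OF ideal.axioms(1)[OF I] mspan_step.IH] by simp
qed

text \<open>
  One step of division: the leading term of \<open>f\<close> is cancelled by a multiple of \<open>g\<close>.
\<close>

lemma single_minus_lm:
  fixes f g :: "'k::field mpoly"
  assumes "g \<noteq> 0" "lm f = a + lm g" "f \<noteq> 0"
  defines "c \<equiv> lookup f (lm f) / lookup g (lm g)"
  defines "f' \<equiv> f - single a c * g"
  shows "c \<noteq> 0" "f' = 0 \<or> lm f' < lm f"
proof -
  have lg: "lookup g (lm g) \<noteq> 0" "lookup f (lm f) \<noteq> 0"
    using lm_in_keys[OF assms(1)] lm_in_keys[OF assms(3)] by (simp_all add: in_keys_iff)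
  then show "c \<noteq> 0" by (simp add: c_def)
  have "lookup f' (lm f) = 0"
    using lg lookup_single_times[of a c g "lm g"]
    by (simp add: f'_def lookup_minus c_def assms(2))
  moreover have "t \<le> lm f" if "t \<in> keys f'" for t
  proof -
    from that have "t \<in> keys f \<or> t \<in> keys (single a c * g)"
      unfolding f'_def using keys_diff[of f "single a c * g"] by blast
    then show ?thesis
      using lm_ge[of t f] lm_ge[of _ g] assms(2)
      by (auto simp: keys_single_times add_left_mono split: if_splits)
  qed
  ultimately show "f' = 0 \<or> lm f' < lm f"
    using lm_in_keys[of f'] unfolding in_keys_iff by (metis order.not_eq_order_implies_strict)
qed

text \<open>
  The Groebner basis property in terms of exponents: it says that the leading monomials of \<open>G\<close> generate
  those of \<open>I\<close>.
\<close>

definition lm_covers :: "(nat \<times> nat) set \<Rightarrow> 'k::field mpoly set \<Rightarrow> 'k mpoly set \<Rightarrow> bool" where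
  "lm_covers X G I \<longleftrightarrow> (\<forall>f \<in> I. f \<noteq> 0 \<longrightarrow> (\<exists>g \<in> G. \<exists>a. keys a \<subseteq> X \<and> lm f = a + lm g))"

lemma lm_keys_subset:
  "f \<in> carrier (KX m n) \<Longrightarrow> f \<noteq> 0 \<Longrightarrow> keys (lm f) \<subseteq> {1..m} \<times> {1..n}"
  using lm_in_keys by (auto simp: KX_carrier_iff)

lemma induct_lm [consumes 1, case_names less zero]:
  fixes f :: "'k::field mpoly"
  assumes "f \<in> carrier (KX m n)"
    and less: "\<And>f. f \<in> carrier (KX m n) \<Longrightarrow>
      (\<And>f'. f' \<in> carrier (KX m n) \<Longrightarrow> f' \<noteq> 0 \<Longrightarrow> lm f' < lm f \<Longrightarrow> Q f') \<Longrightarrow> f \<noteq> 0 \<Longrightarrow> Q f"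
    and zero: "Q 0"
  shows "Q f"
proof -
  let ?X = "{1..m} \<times> {1..n}"
  have "\<forall>f :: 'k mpoly. f \<in> carrier (KX m n) \<longrightarrow> f \<noteq> 0 \<longrightarrow> lm f = s \<longrightarrow> Q f" for s
  proof (induction s rule: wf_induct_rule[OF wf_monom[of ?X]])
    case (2 s)
    show ?case
    proof (intro allI impI)
      fix f :: "'k mpoly" assume f: "f \<in> carrier (KX m n)" "f \<noteq> 0" "lm f = s"
      show "Q f"
        by (rule less[OF f(1) _ f(2)]) (use 2 f lm_keys_subset in blast)
    qed
  qed simp
  then show ?thesis using assms(1) zero by (cases "f = 0") auto
qed

text \<open>
  Repeated cancellation of leading terms ends because the exponents are well-ordered, and it never
  leaves \<open>I\<close>; hence it ends at 0.
\<close>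

lemma division:
  fixes f :: "'k::field mpoly"
  assumes I: "ideal I (KX m n)" and G: "G \<subseteq> I" "0 \<notin> G"
    and cov: "lm_covers ({1..m} \<times> {1..n}) G I" and f: "f \<in> I"
  shows "f \<in> mspan ({1..m} \<times> {1..n}) G (\<lambda>s. s \<le> lm f)"
proof -
  have sub: "I \<subseteq> carrier (KX m n)"
    using additive_subgroup.a_subset[OF ideal.axioms(1)[OF I]] .
  have "f \<in> carrier (KX m n)" using f sub by blast
  then show ?thesis using f
  proof (induction rule: induct_lm)
    case (less f)
    obtain g a where ga: "g \<in> G" "keys a \<subseteq> {1..m} \<times> {1..n}" "lm f = a + lm g"
      using cov less.prems less.hyps by (auto simp: lm_covers_def)
    define c where "c = lookup f (lm f) / lookup g (lm g)"
    define f' where "f' = f - single a c * g"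
    have "g \<noteq> 0" using ga G by auto
    note red = single_minus_lm[OF this ga(3) less(2), folded c_def, folded f'_def]
    have 1: "single a c * g \<in> mspan ({1..m} \<times> {1..n}) G (\<lambda>s. s \<le> lm f)"
      using ga by (intro mspan_one) simp_all
    have "single a (- c) * g \<in> mspan ({1..m} \<times> {1..n}) G (\<lambda>s. s \<le> lm f)"
      using ga by (intro mspan_one) simp_all
    then have "single a (- c) * g \<in> I"
      by (rule mspan_subset_ideal[OF I G(1)])
    then have "f \<oplus>\<^bsub>KX m n\<^esub> single a (- c) * g \<in> I"
      by (rule additive_subgroup.a_closed[OF ideal.axioms(1)[OF I] less.prems])
    then have f': "f' \<in> I" by (simp add: f'_def single_uminus)
    have "f' \<in> mspan ({1..m} \<times> {1..n}) G (\<lambda>s. s \<le> lm f)"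
    proof (cases "f' = 0")
      case False
      then have lt: "lm f' < lm f" using red(2) by simp
      have "f' \<in> carrier (KX m n)" using f' sub by blast
      from less(3)[OF this False lt f'] show ?thesis
        by (rule mspan_mono) (use lt in simp_all)
    qed (simp add: mspan_zero)
    from mspan_add[OF 1 this] show ?case by (simp add: f'_def)
  next
    case zero
    show ?case by (rule mspan_zero)
  qed
qed

text \<open>
  A representation has finitely many summands, so one of them has the largest leading exponent. This
  turns a bound that need not be attained into one that is.
\<close>

lemma mspan_cases:
  assumes "p \<in> mspan X G P"
  shows "p = 0 \<or>
    (\<exists>g a. g \<in> G \<and> keys a \<subseteq> X \<and> P (a + lm g) \<and> p \<in> mspan X G (\<lambda>t. t \<le> a + lm g))"
    (is "_ \<or> ?E p")
  using assms
proof (induction rule: mspan.induct)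
  case mspan_zero
  show ?case by (rule disjI1) (rule refl)
next
  case (mspan_step p g a c)
  let ?q = "single a c * g"
  define v where "v = a + lm g"
  have 1: "?q \<in> mspan X G (\<lambda>t. t \<le> s)" if "v \<le> s" for s
    using mspan_one[of g G a X "\<lambda>t. t \<le> s" c] mspan_step.hyps that unfolding v_def by blast
  have E: "?E (p + ?q)" if "p + ?q \<in> mspan X G (\<lambda>t. t \<le> v)"
    using mspan_step.hyps that unfolding v_def by blast
  from mspan_step.IH show ?case
  proof
    assume "p = 0"
    then show ?thesis using 1[OF order_refl] E by (metis add_0)
  next
    assume "?E p"
    then obtain h b where hb: "h \<in> G" "keys b \<subseteq> X" "P (b + lm h)"
      and p: "p \<in> mspan X G (\<lambda>t. t \<le> b + lm h)" by blast
    show ?thesis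
    proof (cases "v \<le> b + lm h")
      case True
      have "p + ?q \<in> mspan X G (\<lambda>t. t \<le> b + lm h)" by (rule mspan_add[OF 1[OF True] p])
      with hb show ?thesis by blast
    next
      case False
      then have "b + lm h \<le> v" by (metis linear)
      then have "p \<in> mspan X G (\<lambda>t. t \<le> v)"
        by (intro mspan_mono[OF p order_refl]) (rule order_trans)
      then have "p + ?q \<in> mspan X G (\<lambda>t. t \<le> v)" by (rule mspan_add[OF 1[OF order_refl]])
      then show ?thesis using E by blast
    qed
  qed
qed

section \<open>Buchberger's criterion\<close>

text \<open>
  If differences with equal leading exponents can be rewritten below that exponent, the summands that
  reach the bound \<open>u\<close> collapse to a single one.
\<close>

lemma mspan_leading_part:
  fixes G :: "'k::field mpoly set"
  assumes pairs: "\<And>g h a b. g \<in> G \<Longrightarrow> h \<in> G \<Longrightarrow> keys a \<subseteq> X \<Longrightarrow> keys b \<subseteq> X \<Longrightarrow>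
      a + lm g = b + lm h \<Longrightarrow> single a 1 * g - single b 1 * h \<in> mspan X G (\<lambda>s. s < a + lm g)"
    and p: "p \<in> mspan X G (\<lambda>s. s \<le> u)"
  shows "p \<in> mspan X G (\<lambda>s. s < u) \<or>
    (\<exists>g a c. g \<in> G \<and> keys a \<subseteq> X \<and> a + lm g = u \<and> p - single a c * g \<in> mspan X G (\<lambda>s. s < u))"
    (is "_ \<or> ?E p")
  using p
proof (induction rule: mspan.induct)
  case mspan_zero
  show ?case by (rule disjI1) (rule mspan.mspan_zero)
next
  case (mspan_step p g a c)
  let ?q = "single a c * g"
  show ?case
  proof (cases "a + lm g = u")
    case False
    then have "a + lm g < u" using mspan_step.hyps(4) by (rule le_neq_trans[rotated])
    then have q: "?q \<in> mspan X G (\<lambda>s. s < u)"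
      using mspan_one[of g G a X "\<lambda>t. t < u" c] mspan_step.hyps by blast
    from mspan_step.IH show ?thesis
    proof
      assume "p \<in> mspan X G (\<lambda>s. s < u)"
      from mspan_add[OF q this] show ?thesis by blast
    next
      assume "?E p"
      then obtain h b d where hb: "h \<in> G" "keys b \<subseteq> X" "b + lm h = u"
        and ph: "p - single b d * h \<in> mspan X G (\<lambda>s. s < u)" by blast
      have "p + ?q - single b d * h \<in> mspan X G (\<lambda>s. s < u)"
        using mspan_add[OF q ph] by (simp add: algebra_simps)
      with hb show ?thesis by blast
    qed
  next
    case True
    from mspan_step.IH show ?thesis
    proof
      assume "p \<in> mspan X G (\<lambda>s. s < u)"
      then have "p + ?q - ?q \<in> mspan X G (\<lambda>s. s < u)" by simp
      with mspan_step.hyps True show ?thesis by blast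
    next
      assume "?E p"
      then obtain h b d where hb: "h \<in> G" "keys b \<subseteq> X" "b + lm h = u"
        and ph: "p - single b d * h \<in> mspan X G (\<lambda>s. s < u)" by blast
      have "a + lm g = b + lm h" using hb(3) True by (simp only:)
      from pairs[OF mspan_step.hyps(2) hb(1) mspan_step.hyps(3) hb(2) this]
      have "single a 1 * g - single b 1 * h \<in> mspan X G (\<lambda>s. s < u)" unfolding True .
      \<comment> \<open>The coefficient of the new multiple of \<open>g\<close> is moved to \<open>h\<close>,
        at the cost of terms with exponent below \<open>u\<close>.\<close>
      from mspan_add[OF ph mspan_scale[OF this, of c]]
      have "single 0 c * (single a 1 * g - single b 1 * h) + (p - single b d * h) \<in> mspan X G (\<lambda>s. s < u)" .
      moreover have "single 0 c * (single a 1 * g - single b 1 * h) = ?q - single b c * h"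
        by (simp add: right_diff_distrib mult.assoc[symmetric] mult_single)
      ultimately have "?q - single b c * h + (p - single b d * h) \<in> mspan X G (\<lambda>s. s < u)" by simp
      moreover have "?q - single b c * h + (p - single b d * h) = p + ?q - single b (d + c) * h"
        by (simp add: single_add distrib_right)
      ultimately have "p + ?q - single b (d + c) * h \<in> mspan X G (\<lambda>s. s < u)" by simp
      with hb show ?thesis by blast
    qed
  qed
qed

text \<open>
  Buchberger's criterion. A representation of \<open>f\<close> with the least possible bound has a single summand
  at that bound, and nothing cancels it, so the bound is the leading monomial of \<open>f\<close>.
\<close>

lemma lm_covers_of_pairs:
  fixes G :: "'k::field mpoly set" and m n :: nat
  defines "X \<equiv> {1..m} \<times> {1..n}"
  assumes G: "G \<subseteq> carrier (KX m n)" "\<And>g. g \<in> G \<Longrightarrow> lookup g (lm g) = 1"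
    and pairs: "\<And>g h a b. g \<in> G \<Longrightarrow> h \<in> G \<Longrightarrow> keys a \<subseteq> X \<Longrightarrow> keys b \<subseteq> X \<Longrightarrow>
      a + lm g = b + lm h \<Longrightarrow> single a 1 * g - single b 1 * h \<in> mspan X G (\<lambda>s. s < a + lm g)"
  shows "lm_covers X G (Idl\<^bsub>KX m n\<^esub> G)"
proof -
  have gX: "keys (a + lm g) \<subseteq> X" if "g \<in> G" "keys a \<subseteq> X" for g a
  proof -
    have "g \<noteq> 0" using G(2)[OF that(1)] by auto
    then show ?thesis
      using lm_keys_subset[of g m n] that G(1) keys_add[of a "lm g"] by (auto simp: X_def)
  qed
  have *: "\<forall>p. p \<in> mspan X G (\<lambda>t. t \<le> s) \<longrightarrow> p \<noteq> 0 \<longrightarrow> (\<exists>g \<in> G. \<exists>a. keys a \<subseteq> X \<and> lm p = a + lm g)"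
    if "keys s \<subseteq> X" for s
    using that
  proof (induction s rule: wf_induct_rule[OF wf_monom[of X]])
    case 1
    show ?case by (simp add: X_def)
  next
    case (2 s)
    have low: "\<exists>g \<in> G. \<exists>a. keys a \<subseteq> X \<and> lm p = a + lm g"
      if "p \<in> mspan X G (\<lambda>t. t < s)" "p \<noteq> 0" for p
    proof -
      from mspan_cases[OF that(1)] that(2) obtain g a where ga: "g \<in> G" "keys a \<subseteq> X"
        "a + lm g < s" "p \<in> mspan X G (\<lambda>t. t \<le> a + lm g)" by blast
      then show ?thesis using 2 gX[OF ga(1,2)] that(2) by blast
    qed
    show ?case
    proof (intro allI impI)
      fix p assume p: "p \<in> mspan X G (\<lambda>t. t \<le> s)" "p \<noteq> 0"
      from mspan_leading_part[OF pairs p(1)]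
      show "\<exists>g \<in> G. \<exists>a. keys a \<subseteq> X \<and> lm p = a + lm g"
      proof
        assume "p \<in> mspan X G (\<lambda>t. t < s)"
        then show ?thesis using low p(2) by blast
      next
        assume "\<exists>g a c. g \<in> G \<and> keys a \<subseteq> X \<and> a + lm g = s \<and> p - single a c * g \<in> mspan X G (\<lambda>t. t < s)"
        then obtain g a c where ga: "g \<in> G" "keys a \<subseteq> X" "a + lm g = s"
          and q: "p - single a c * g \<in> mspan X G (\<lambda>t. t < s)" by blast
        show ?thesis
        proof (cases "c = 0")
          case True
          then show ?thesis using low[of p] q p(2) by simp
        next
          case False
          let ?q = "p - single a c * g"
          have pq: "p = ?q + single a c * g" by simp
          have "s \<notin> keys ?q" using keys_rep[OF q] by blast
          then have "lookup ?q s = 0" unfolding in_keys_iff by (rule notnotD)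
          moreover have "lookup (single a c * g) s = c"
            using lookup_single_times[of a c g "lm g"] G(2)[OF ga(1)] ga(3) by simp
          ultimately have "lookup p s = c"
            unfolding lookup_minus by simp
          moreover have "u \<le> s" if "u \<in> keys p" for u
          proof -
            from that have "u \<in> keys ?q \<or> u \<in> keys (single a c * g)"
              using keys_add[of ?q "single a c * g"] unfolding diff_add_cancel by blast
            then show ?thesis
            proof
              assume "u \<in> keys ?q"
              from keys_rep[OF q this] show ?thesis by (rule less_imp_le)
            next
              assume "u \<in> keys (single a c * g)"
              then obtain v where "v \<in> keys g" "u = a + v" using False
                by (auto simp: keys_single_times)
              then show ?thesis using ga(3) lm_ge add_left_mono by blast
            qed
          qed
          ultimately have "lm p = s" using False by (intro lm_unique) (simp_all add: in_keys_iff)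
          then have "lm p = a + lm g" using ga(3) by (simp only:)
          with ga(1,2) show ?thesis by (intro bexI[of _ g] exI[of _ a] conjI)
        qed
      qed
    qed
  qed
  show ?thesis
    unfolding lm_covers_def
  proof (intro ballI impI)
    fix f assume "f \<in> Idl\<^bsub>KX m n\<^esub> G" "f \<noteq> 0"
    then have "f \<in> mspan X G (\<lambda>_. True)" using Idl_subset_rep[OF G(1)] by (auto simp: X_def)
    from mspan_cases[OF this] \<open>f \<noteq> 0\<close> obtain g a where "g \<in> G" "keys a \<subseteq> X"
      "f \<in> mspan X G (\<lambda>t. t \<le> a + lm g)" by blast
    then show "\<exists>g \<in> G. \<exists>a. keys a \<subseteq> X \<and> lm f = a + lm g"
      using *[OF gX] \<open>f \<noteq> 0\<close> by blast
  qed
qed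

lemma lookup_tail:
  fixes g :: "'k::field mpoly"
  assumes "lookup g (lm g) = 1"
  shows "b \<in> keys (single (lm g) 1 - g) \<Longrightarrow> b \<in> keys g \<and> b < lm g"
proof -
  assume b: "b \<in> keys (single (lm g) 1 - g)"
  then have "b \<noteq> lm g" using assms by (auto simp: in_keys_iff lookup_minus)
  moreover from this b have "b \<in> keys g"
    by (auto simp: in_keys_iff lookup_minus lookup_single_not_eq)
  ultimately show ?thesis using lm_ge[of b g] by (simp add: order.not_eq_order_implies_strict)
qed

text \<open>
  Buchberger's product criterion. Equality of the leading exponents and coprimality give
  \<open>a = d + lm h\<close> and \<open>b = d + lm g\<close>, so the two multipliers are a common monomial times the leading
  monomials of \<open>h\<close> and \<open>g\<close>. Writing these as \<open>h + th\<close> and \<open>g + tg\<close> cancels the product \<open>g * h\<close> and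
  leaves multiples by the smaller monomials of \<open>th\<close> and \<open>tg\<close>.
\<close>

lemma coprime_pair:
  fixes G :: "'k::field mpoly set"
  assumes g: "g \<in> G" "lookup g (lm g) = 1" "\<And>t. t \<in> keys g \<Longrightarrow> keys t \<subseteq> X"
    and h: "h \<in> G" "lookup h (lm h) = 1" "\<And>t. t \<in> keys h \<Longrightarrow> keys t \<subseteq> X"
    and disj: "keys (lm g) \<inter> keys (lm h) = {}"
    and ab: "keys a \<subseteq> X" "a + lm g = b + lm h"
  shows "single a 1 * g - single b 1 * h \<in> mspan X G (\<lambda>s. s < a + lm g)"
proof -
  define d where "d = a - lm h"
  have eq: "lookup a x + lookup (lm g) x = lookup b x + lookup (lm h) x" for x
    using ab(2) by (metis lookup_add)
  have disj': "lookup (lm g) x = 0 \<or> lookup (lm h) x = 0" for x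
    using disj by (auto simp: in_keys_iff)
  have a: "a = d + lm h"
  proof (rule poly_mapping_eqI)
    fix x
    have "lookup (lm h) x \<le> lookup a x" using eq[of x] disj'[of x] by linarith
    then show "lookup a x = lookup (d + lm h) x"
      by (simp add: d_def lookup_add minus_poly_mapping.rep_eq)
  qed
  have "b + lm h = (d + lm g) + lm h"
    using ab(2) unfolding a by (simp only: ac_simps)
  then have b: "b = d + lm g" by (rule add_right_imp_eq)
  have dX: "keys d \<subseteq> X"
    using ab(1) by (auto simp: a in_keys_iff lookup_add)
  define th where "th = single (lm h) 1 - h"
  define tg where "tg = single (lm g) 1 - g"
  have "th * g \<in> mspan X G (\<lambda>s. s < lm h + lm g)"
  proof (rule mspan_mult)
    show "g \<in> mspan X G (\<lambda>s. s = lm g)"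
      using mspan_one[of g G 0 X "\<lambda>s. s = lm g" 1] g(1) by simp
    fix c s assume c: "c \<in> keys th"
    note tl = lookup_tail[OF h(2) c[unfolded th_def]]
    then show "keys c \<subseteq> X" using h(3) by blast
    assume "s = lm g"
    then show "c + s < lm h + lm g" using tl by (simp add: add_strict_right_mono)
  qed
  moreover have "tg * h \<in> mspan X G (\<lambda>s. s < lm h + lm g)"
  proof (rule mspan_mult)
    show "h \<in> mspan X G (\<lambda>s. s = lm h)"
      using mspan_one[of h G 0 X "\<lambda>s. s = lm h" 1] h(1) by simp
    fix c s assume c: "c \<in> keys tg"
    note tl = lookup_tail[OF g(2) c[unfolded tg_def]]
    then show "keys c \<subseteq> X" using g(3) by blast
    assume "s = lm h"
    then show "c + s < lm h + lm g" using tl by (simp add: add.commute add_strict_right_mono)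
  qed
  ultimately have "th * g - tg * h \<in> mspan X G (\<lambda>s. s < lm h + lm g)"
    using mspan_diff by blast
  then have "single d 1 * (th * g - tg * h) \<in> mspan X G (\<lambda>s. s < a + lm g)"
    by (rule mspan_shift[OF _ dX]) (simp add: a add.assoc add_strict_left_mono)
  moreover have "th * g - tg * h = single (lm h) 1 * g - single (lm g) 1 * h"
    by (simp add: th_def tg_def left_diff_distrib mult.commute[of h g])
  moreover have "single d 1 * (single (lm h) 1 * g - single (lm g) 1 * h) = single a 1 * g - single b 1 * h"
    by (simp add: a b right_diff_distrib mult.assoc[symmetric] mult_single)
  ultimately show ?thesis by simp
qed

section \<open>Groebner bases and radical ideals\<close>

lemma KX_nat_pow:
  fixes f :: "'k::field mpoly"
  shows "f [^]\<^bsub>KX m n\<^esub> (e :: nat) = f ^ e"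
proof -
  interpret cring "KX m n :: 'k mpoly ring" by (rule cring_KX)
  show ?thesis by (induction e) (simp_all add: nat_pow_Suc mult.commute)
qed

lemma KX_power_closed:
  "f \<in> carrier (KX m n) \<Longrightarrow> f ^ e \<in> carrier (KX m n)"
  by (induction e) (simp_all add: KX_closed)

lemma ideal_KX_closed:
  fixes I :: "'k::field mpoly set"
  assumes "ideal I (KX m n)"
  shows "I \<subseteq> carrier (KX m n)" "0 \<in> I"
    and "f \<in> I \<Longrightarrow> g \<in> I \<Longrightarrow> f + g \<in> I"
    and "f \<in> I \<Longrightarrow> h \<in> carrier (KX m n) \<Longrightarrow> h * f \<in> I"
    and "f \<in> I \<Longrightarrow> g \<in> I \<Longrightarrow> f - g \<in> I"
proof -
  note sub = ideal.axioms(1)[OF assms]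
  show "I \<subseteq> carrier (KX m n)" by (rule additive_subgroup.a_subset[OF sub])
  show "0 \<in> I" using additive_subgroup.zero_closed[OF sub] by simp
  show add: "f + g \<in> I" if "f \<in> I" "g \<in> I" for f g
    using additive_subgroup.a_closed[OF sub that] by simp
  show mult: "h * f \<in> I" if "f \<in> I" "h \<in> carrier (KX m n)" for f h
    using ideal.I_l_closed[OF assms that] by simp
  have "(-1 :: 'k mpoly) \<in> carrier (KX m n)" using KX_closed(3)[OF KX_zero_one(2) KX_zero_one(2)] .
  from add[OF _ mult[OF _ this]] show "f - g \<in> I" if "f \<in> I" "g \<in> I"
    using that by fastforce
qed

text \<open>
  By induction on \<open>lm f\<close>: if \<open>f ^ e \<in> I\<close>, then a squarefree \<open>lm g\<close> divides \<open>lm (f ^ e) = e lm f\<close>, so it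
  divides \<open>lm f\<close>. Cancelling the leading term of \<open>f\<close> with \<open>g\<close> changes \<open>f\<close>, hence also \<open>f ^ e\<close>, by an
  element of \<open>I\<close>.
\<close>

lemma squarefree_lm_imp_radical:
  fixes G I :: "'k::field mpoly set"
  assumes I: "ideal I (KX m n)" and G: "G \<subseteq> I" "0 \<notin> G"
    and sqf: "\<And>g x. g \<in> G \<Longrightarrow> lookup (lm g) x \<le> 1"
    and cov: "lm_covers ({1..m} \<times> {1..n}) G I"
  shows "radical (KX m n) I = I"
proof
  note Ic = ideal_KX_closed[OF I]
  show "I \<subseteq> radical (KX m n) I"
  proof
    fix f assume f: "f \<in> I"
    then have "f [^]\<^bsub>KX m n\<^esub> (1::nat) \<in> I" by (simp only: KX_nat_pow power_one_right)
    then show "f \<in> radical (KX m n) I"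
      using f Ic(1) unfolding radical_def by blast
  qed
  have root: "f ^ e \<in> I \<longrightarrow> f \<in> I" if "f \<in> carrier (KX m n)" "0 < e" for f e
    using that(1)
  proof (induction rule: induct_lm)
    case (less f)
    show ?case
    proof
      assume fe: "f ^ e \<in> I"
      have pw: "f ^ e \<noteq> 0" "\<And>x. lookup (lm (f ^ e)) x = e * lookup (lm f) x"
        using lm_power[OF less(2)] by blast+
      obtain g b where gb: "g \<in> G" "lm (f ^ e) = b + lm g"
        using cov fe pw(1) unfolding lm_covers_def by blast
      define a where "a = lm f - lm g"
      have le: "lookup (lm g) x \<le> lookup (lm f) x" for x
      proof -
        have "lookup (lm g) x \<le> e * lookup (lm f) x"
          unfolding pw(2)[symmetric] gb(2) lookup_add by simp
        with sqf[OF gb(1), of x] show ?thesis by (cases "lookup (lm f) x") auto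
      qed
      have a: "lm f = a + lm g"
        by (rule poly_mapping_eqI) (simp add: a_def lookup_add minus_poly_mapping.rep_eq le)
      have aX: "keys a \<subseteq> {1..m} \<times> {1..n}"
      proof -
        have "keys a \<subseteq> keys (lm f)" by (auto simp: a in_keys_iff lookup_add)
        with lm_keys_subset[OF less(1,2)] show ?thesis by blast
      qed
      define c where "c = lookup f (lm f) / lookup g (lm g)"
      define h where "h = single a c * g"
      have "g \<noteq> 0" using gb G by auto
      note red = single_minus_lm[OF this a less(2), folded c_def, folded h_def]
      have "single a c \<in> carrier (KX m n)" using aX by (auto simp: KX_carrier_iff)
      then have hI: "h \<in> I" unfolding h_def using G(1) gb(1) by (intro Ic(4)) blast+
      have hK: "h \<in> carrier (KX m n)" using hI Ic(1) by blast
      have f'K: "f - h \<in> carrier (KX m n)"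
        using KX_closed(1)[OF less(1) KX_closed(3)[OF hK hK]] by simp
      \<comment> \<open>The cofactor of \<open>h\<close> in the difference of the two powers.\<close>
      define q where "q = (\<Sum>i<e. (f - h) ^ (e - Suc i) * f ^ i)"
      have "q \<in> carrier (KX m n)" unfolding q_def
        by (intro KX_sum_closed KX_closed(2) KX_power_closed f'K less(1))
      then have "q * h \<in> I" by (rule Ic(4)[OF hI])
      have "f ^ e - (f - h) ^ e = (f - (f - h)) * q"
        unfolding q_def by (rule power_diff_sumr2)
      then have "(f - h) ^ e = f ^ e - q * h" by (simp add: algebra_simps)
      then have "(f - h) ^ e \<in> I" using Ic(5)[OF fe \<open>q * h \<in> I\<close>] by simp
      then have "f - h \<in> I" using red(2) less(3)[OF f'K] Ic(2) by (cases "f - h = 0") auto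
      from Ic(3)[OF this hI] show "f \<in> I" by simp
    qed
  next
    case zero
    show ?case using Ic(2) by blast
  qed
  show "radical (KX m n) I \<subseteq> I"
    unfolding radical_def KX_nat_pow using root by blast
qed

lemma lm_covers_imp_groebner_basis:
  fixes G I :: "'k::field mpoly set"
  assumes I: "ideal I (KX m n)" and G: "finite G" "G \<subseteq> I" "0 \<notin> G"
    and cov: "lm_covers ({1..m} \<times> {1..n}) G I"
  shows "groebner_basis m n G I"
proof -
  interpret cring "KX m n :: 'k mpoly ring" by (rule cring_KX)
  note Ic = ideal_KX_closed[OF I]
  have init: "initial_term f = single (lm f) (lookup f (lm f))" for f :: "'k mpoly"
    by (simp add: initial_term_def lm_def Let_def)
  have initK: "initial_term f \<in> carrier (KX m n)" if "f \<in> carrier (KX m n)" for f :: "'k mpoly"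
    using lm_keys_subset[OF that] by (cases "f = 0") (simp_all add: init KX_carrier_iff)
  then have inI: "initial_term ` I \<subseteq> carrier (KX m n)" and inG: "initial_term ` G \<subseteq> carrier (KX m n)"
    using Ic(1) G(2) by blast+
  note J = ideal_KX_closed[OF genideal_ideal[OF inG]]
  have "initial_term ` I \<subseteq> Idl\<^bsub>KX m n\<^esub> (initial_term ` G)"
  proof
    fix t assume "t \<in> initial_term ` I"
    then obtain f where f: "f \<in> I" "t = initial_term f" by blast
    show "t \<in> Idl\<^bsub>KX m n\<^esub> (initial_term ` G)"
    proof (cases "f = 0")
      case True
      then show ?thesis using J(2) f(2) by simp
    next
      case False
      then obtain g a where ga: "g \<in> G" "keys a \<subseteq> {1..m} \<times> {1..n}" "lm f = a + lm g"
        using cov f(1) unfolding lm_covers_def by blast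
      have "g \<noteq> 0" using ga G by auto
      then have nz: "lookup g (lm g) \<noteq> 0" using lm_in_keys by (auto simp: in_keys_iff)
      have "initial_term g \<in> Idl\<^bsub>KX m n\<^esub> (initial_term ` G)"
        using genideal_self[OF inG] ga(1) by blast
      moreover have "single a (lookup f (lm f) / lookup g (lm g)) \<in> carrier (KX m n)"
        using ga(2) by (auto simp: KX_carrier_iff)
      ultimately have "single a (lookup f (lm f) / lookup g (lm g)) * initial_term g
          \<in> Idl\<^bsub>KX m n\<^esub> (initial_term ` G)"
        by (rule J(4))
      moreover have "single a (lookup f (lm f) / lookup g (lm g)) * initial_term g = t"
        using nz by (simp add: init mult_single f(2) ga(3)[symmetric])
      ultimately show ?thesis by simp
    qed
  qed
  then have "Idl\<^bsub>KX m n\<^esub> (initial_term ` I) \<subseteq> Idl\<^bsub>KX m n\<^esub> (initial_term ` G)"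
    by (rule genideal_minimal[OF genideal_ideal[OF inG]])
  moreover have "Idl\<^bsub>KX m n\<^esub> (initial_term ` G) \<subseteq> Idl\<^bsub>KX m n\<^esub> (initial_term ` I)"
    by (rule genideal_minimal[OF genideal_ideal[OF inI]])
       (use genideal_self[OF inI] G(2) in blast)
  ultimately show ?thesis using G by (simp add: groebner_basis_def)
qed

section \<open>Matrices of bounded rank\<close>

text \<open>
  A vector that lies outside the span of finitely many others is separated from them by a linear
  functional; this is the only tool from linear algebra that the rank arguments need.
\<close>

lemma fredholm_alternative:
  fixes z :: "'b \<Rightarrow> nat \<Rightarrow> 'l::field"
  assumes "finite J"
  shows "(\<exists>w. \<forall>p<r. v p = (\<Sum>b\<in>J. z b p * w b)) \<or>
    (\<exists>\<phi>. (\<forall>b\<in>J. (\<Sum>p<r. \<phi> p * z b p) = 0) \<and> (\<Sum>p<r. \<phi> p * v p) \<noteq> 0)"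
  using assms
proof (induction J arbitrary: v rule: finite_induct)
  case empty
  show ?case
  proof (cases "\<forall>p<r. v p = 0")
    case False
    then obtain p where p: "p < r" "v p \<noteq> 0" by blast
    have "(\<Sum>q<r. (if q = p then 1 else 0) * v q) = (\<Sum>q<r. if q = p then v q else 0)"
      by (rule sum.cong) auto
    also have "\<dots> = v p" using p by simp
    finally show ?thesis using p by (intro disjI2 exI[of _ "\<lambda>q. if q = p then 1 else 0"]) simp
  qed simp
next
  case (insert b0 J)
  show ?case
  proof (cases "\<exists>w. \<forall>p<r. z b0 p = (\<Sum>b\<in>J. z b p * w b)")
    case True
    then obtain w0 where w0: "\<And>p. p < r \<Longrightarrow> z b0 p = (\<Sum>b\<in>J. z b p * w0 b)" by blast
    from insert.IH[of v] show ?thesis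
    proof
      assume "\<exists>w. \<forall>p<r. v p = (\<Sum>b\<in>J. z b p * w b)"
      then obtain w where w: "\<And>p. p < r \<Longrightarrow> v p = (\<Sum>b\<in>J. z b p * w b)" by blast
      have "(\<Sum>b\<in>insert b0 J. z b p * (w(b0 := 0)) b) = (\<Sum>b\<in>J. z b p * w b)" for p
        using insert.hyps by (simp add: sum.insert) (rule sum.cong, auto)
      with w show ?thesis by (intro disjI1 exI[of _ "w(b0 := 0)"]) simp
    next
      assume "\<exists>\<phi>. (\<forall>b\<in>J. (\<Sum>p<r. \<phi> p * z b p) = 0) \<and> (\<Sum>p<r. \<phi> p * v p) \<noteq> 0"
      then obtain \<phi> where \<phi>: "\<And>b. b \<in> J \<Longrightarrow> (\<Sum>p<r. \<phi> p * z b p) = 0" "(\<Sum>p<r. \<phi> p * v p) \<noteq> 0"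
        by blast
      have "(\<Sum>p<r. \<phi> p * z b0 p) = (\<Sum>p<r. \<Sum>b\<in>J. \<phi> p * z b p * w0 b)"
        by (rule sum.cong) (simp_all add: w0 sum_distrib_left mult.assoc)
      also have "\<dots> = (\<Sum>b\<in>J. \<Sum>p<r. \<phi> p * z b p * w0 b)" by (rule sum.swap)
      also have "\<dots> = (\<Sum>b\<in>J. (\<Sum>p<r. \<phi> p * z b p) * w0 b)" by (simp add: sum_distrib_right)
      also have "\<dots> = 0" using \<phi>(1) by simp
      finally show ?thesis using \<phi> by (intro disjI2 exI[of _ \<phi>]) auto
    qed
  next
    case False
    with insert.IH[of "z b0"] obtain \<phi>0 where \<phi>0: "\<And>b. b \<in> J \<Longrightarrow> (\<Sum>p<r. \<phi>0 p * z b p) = 0"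
      "(\<Sum>p<r. \<phi>0 p * z b0 p) \<noteq> 0" by blast
    define k where "k = (\<Sum>p<r. \<phi>0 p * z b0 p)"
    define l where "l = (\<Sum>p<r. \<phi>0 p * v p) / k"
    from insert.IH[of "\<lambda>p. v p - l * z b0 p"] show ?thesis
    proof
      assume "\<exists>w. \<forall>p<r. v p - l * z b0 p = (\<Sum>b\<in>J. z b p * w b)"
      then obtain w where w: "\<And>p. p < r \<Longrightarrow> v p - l * z b0 p = (\<Sum>b\<in>J. z b p * w b)" by blast
      have "(\<Sum>b\<in>insert b0 J. z b p * (w(b0 := l)) b) = z b0 p * l + (\<Sum>b\<in>J. z b p * w b)" for p
        using insert.hyps by (simp add: sum.insert) (rule sum.cong, auto)
      with w have "v p = (\<Sum>b\<in>insert b0 J. z b p * (w(b0 := l)) b)" if "p < r" for p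
        using that by (simp add: algebra_simps)
      then show ?thesis by blast
    next
      assume "\<exists>\<phi>. (\<forall>b\<in>J. (\<Sum>p<r. \<phi> p * z b p) = 0) \<and> (\<Sum>p<r. \<phi> p * (v p - l * z b0 p)) \<noteq> 0"
      then obtain \<phi> where \<phi>: "\<And>b. b \<in> J \<Longrightarrow> (\<Sum>p<r. \<phi> p * z b p) = 0"
        "(\<Sum>p<r. \<phi> p * (v p - l * z b0 p)) \<noteq> 0"
        by blast
      define j where "j = (\<Sum>p<r. \<phi> p * z b0 p) / k"
      let ?\<psi> = "\<lambda>p. \<phi> p - j * \<phi>0 p"
      have \<psi>: "(\<Sum>p<r. ?\<psi> p * u p) = (\<Sum>p<r. \<phi> p * u p) - j * (\<Sum>p<r. \<phi>0 p * u p)" for u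
        by (simp add: left_diff_distrib sum_subtractf sum_distrib_left mult.assoc)
      have "(\<Sum>p<r. ?\<psi> p * z b p) = 0" if "b \<in> insert b0 J" for b
      proof (cases "b = b0")
        case True
        have "k \<noteq> 0" using \<phi>0(2) by (simp add: k_def)
        then show ?thesis unfolding True \<psi> k_def[symmetric] by (simp add: j_def)
      next
        case False
        then show ?thesis using that \<phi>(1) \<phi>0(1) unfolding \<psi> by simp
      qed
      moreover have "(\<Sum>p<r. \<phi> p * (v p - l * z b0 p)) = (\<Sum>p<r. \<phi> p * v p) - l * (\<Sum>p<r. \<phi> p * z b0 p)"
        by (simp add: right_diff_distrib sum_subtractf sum_distrib_left mult.left_commute)
      moreover have "l * (\<Sum>p<r. \<phi> p * z b0 p) = j * (\<Sum>p<r. \<phi>0 p * v p)"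
        by (simp add: l_def j_def)
      ultimately have "\<forall>b\<in>insert b0 J. (\<Sum>p<r. ?\<psi> p * z b p) = 0" "(\<Sum>p<r. ?\<psi> p * v p) \<noteq> 0"
        using \<phi>(2) \<psi>[of v] by simp_all
      then show ?thesis by (intro disjI2 exI[of _ ?\<psi>] conjI)
    qed
  qed
qed

text \<open>
  The block with rows \<open>I\<close> and columns \<open>J\<close> has rank at most \<open>r\<close>. A factorization through \<open>r\<close> dimensions
  encodes this, since row and column operations act directly on the factors.
\<close>

definition rank_le :: "nat set \<Rightarrow> nat set \<Rightarrow> nat \<Rightarrow> (nat \<times> nat \<Rightarrow> 'l::field) \<Rightarrow> bool" where
  "rank_le I J r A \<longleftrightarrow> (\<exists>Y Z. \<forall>a \<in> I. \<forall>b \<in> J. A (a, b) = (\<Sum>l<r. Y a l * Z l b))"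

lemma rank_leI:
  "(\<And>a b. a \<in> I \<Longrightarrow> b \<in> J \<Longrightarrow> A (a, b) = (\<Sum>l<r. Y a l * Z l b)) \<Longrightarrow> rank_le I J r A"
  unfolding rank_le_def by blast

lemma rank_le_subset: "rank_le I J r A \<Longrightarrow> I' \<subseteq> I \<Longrightarrow> J' \<subseteq> J \<Longrightarrow> rank_le I' J' r A"
  unfolding rank_le_def by (meson subsetD)

lemma rank_le_cong:
  "rank_le I J r A \<Longrightarrow> (\<And>a b. a \<in> I \<Longrightarrow> b \<in> J \<Longrightarrow> A (a, b) = A' (a, b)) \<Longrightarrow> rank_le I J r A'"
  unfolding rank_le_def by simp

lemma rank_le_mono:
  assumes "rank_le I J r A" "r \<le> r'"
  shows "rank_le I J r' A"
proof -
  obtain Y Z where YZ: "\<And>a b. a \<in> I \<Longrightarrow> b \<in> J \<Longrightarrow> A (a, b) = (\<Sum>l<r. Y a l * Z l b)"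
    using assms(1) unfolding rank_le_def by blast 
  have "(\<Sum>l<r'. (if l < r then Y a l else 0) * Z l b) = (\<Sum>l<r. Y a l * Z l b)" for a b
    using assms(2) by (intro sum.mono_neutral_cong_right) auto
  then show ?thesis by (intro rank_leI[where Y = "\<lambda>a l. if l < r then Y a l else 0" and Z = Z])
      (simp add: YZ)
qed

lemma rank_le_zero: "rank_le I J r (\<lambda>_. 0)"
  by (rule rank_leI[where Y = "\<lambda>_ _. 0" and Z = "\<lambda>_ _. 0"]) simp

lemma rank_le_add_row:
  assumes "rank_le I J r A" "i \<in> I"
  shows "rank_le I J r (\<lambda>(a, b). A (a, b) + y a * A (i, b))"
proof -
  obtain Y Z where YZ: "\<And>a b. a \<in> I \<Longrightarrow> b \<in> J \<Longrightarrow> A (a, b) = (\<Sum>l<r. Y a l * Z l b)"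
    using assms(1) unfolding rank_le_def by blast
  show ?thesis
    by (rule rank_leI[where Y = "\<lambda>a l. Y a l + y a * Y i l" and Z = Z])
       (simp add: YZ assms(2) distrib_right sum.distrib sum_distrib_left mult.assoc)
qed

lemma rank_le_add_col:
  assumes "rank_le I J r A" "q \<in> J"
  shows "rank_le I J r (\<lambda>(a, b). A (a, b) + A (a, q) * z b)"
proof -
  obtain Y Z where YZ: "\<And>a b. a \<in> I \<Longrightarrow> b \<in> J \<Longrightarrow> A (a, b) = (\<Sum>l<r. Y a l * Z l b)"
    using assms(1) unfolding rank_le_def by blast
  show ?thesis
    by (rule rank_leI[where Y = Y and Z = "\<lambda>l b. Z l b + Z l q * z b"])
       (simp add: YZ assms(2) distrib_left sum.distrib sum_distrib_right mult.assoc)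
qed

text \<open>
  If the new column were outside the span of the others, a functional would vanish on the right-hand
  factor of every other column, and one of the \<open>r\<close> inner coordinates could be eliminated.
\<close>

lemma column_in_span:
  assumes "finite J" and A: "rank_le I (insert q J) r A"
    and min: "\<And>r'. r = Suc r' \<Longrightarrow> \<not> rank_le I J r' A"
  obtains w where "\<And>a. a \<in> I \<Longrightarrow> A (a, q) = (\<Sum>b\<in>J. A (a, b) * w b)"
proof -
  obtain Y Z where YZ: "\<And>a b. a \<in> I \<Longrightarrow> b \<in> insert q J \<Longrightarrow> A (a, b) = (\<Sum>l<r. Y a l * Z l b)"
    using A unfolding rank_le_def by blast
  from fredholm_alternative[OF assms(1), of r "\<lambda>l. Z l q" "\<lambda>b l. Z l b"] show thesis
  proof
    assume "\<exists>w. \<forall>p<r. Z p q = (\<Sum>b\<in>J. Z p b * w b)"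
    then obtain w where w: "\<And>p. p < r \<Longrightarrow> Z p q = (\<Sum>b\<in>J. Z p b * w b)" by blast
    have "A (a, q) = (\<Sum>b\<in>J. A (a, b) * w b)" if a: "a \<in> I" for a
    proof -
      have "A (a, q) = (\<Sum>l<r. \<Sum>b\<in>J. Y a l * Z l b * w b)"
        by (simp add: YZ a w sum_distrib_left mult.assoc)
      also have "\<dots> = (\<Sum>b\<in>J. \<Sum>l<r. Y a l * Z l b * w b)" by (rule sum.swap)
      also have "\<dots> = (\<Sum>b\<in>J. A (a, b) * w b)"
        by (simp add: YZ a sum_distrib_right)
      finally show ?thesis .
    qed
    then show thesis by (rule that)
  next
    assume "\<exists>\<phi>. (\<forall>b\<in>J. (\<Sum>p<r. \<phi> p * Z p b) = 0) \<and> (\<Sum>p<r. \<phi> p * Z p q) \<noteq> 0"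
    then obtain \<phi> where \<phi>: "\<And>b. b \<in> J \<Longrightarrow> (\<Sum>p<r. \<phi> p * Z p b) = 0" "(\<Sum>p<r. \<phi> p * Z p q) \<noteq> 0"
      by blast
    then obtain p where p: "p < r" "\<phi> p \<noteq> 0"
      by (metis (no_types, lifting) lessThan_iff mult_zero_left sum.neutral)
    obtain r' where r': "r = Suc r'" using p(1) by (cases r) auto
    \<comment> \<open>Enumerates the inner coordinates other than \<open>p\<close>.\<close>
    define e where "e l = (if l < p then l else Suc l)" for l
    have bij: "bij_betw e {..<r'} ({..<r} - {p})"
      unfolding bij_betw_def
    proof
      show "inj_on e {..<r'}" by (auto simp: inj_on_def e_def split: if_splits)
      show "e ` {..<r'} = {..<r} - {p}"
      proof
        show "e ` {..<r'} \<subseteq> {..<r} - {p}" using p r' by (auto simp: e_def)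
        show "{..<r} - {p} \<subseteq> e ` {..<r'}"
        proof
          fix l assume l: "l \<in> {..<r} - {p}"
          show "l \<in> e ` {..<r'}"
          proof (cases "l < p")
            case True
            then show ?thesis using p r' by (intro image_eqI[of _ _ l]) (auto simp: e_def)
          next
            case False
            then show ?thesis using l r' by (intro image_eqI[of _ _ "l - 1"]) (auto simp: e_def)
          qed
        qed
      qed
    qed
    have split: "(\<Sum>l<r. f l) = f p + (\<Sum>l<r'. f (e l))" for f :: "nat \<Rightarrow> 'a"
      using p(1) sum.remove[of "{..<r}" p f] sum.reindex_bij_betw[OF bij, of f] by simp
    have Zp: "Z p b = - (\<Sum>l<r'. \<phi> (e l) / \<phi> p * Z (e l) b)" if "b \<in> J" for b
    proof -
      have "\<phi> p * Z p b + (\<Sum>l<r'. \<phi> (e l) * Z (e l) b) = 0"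
        using \<phi>(1)[OF that] unfolding split .
      then have "Z p b = - (\<Sum>l<r'. \<phi> (e l) * Z (e l) b) / \<phi> p"
        using p(2) by (simp add: field_simps eq_neg_iff_add_eq_0)
      then show ?thesis by (simp add: sum_divide_distrib)
    qed
    have "rank_le I J r' A"
    proof (rule rank_leI[where Y = "\<lambda>a l. Y a (e l) - Y a p * (\<phi> (e l) / \<phi> p)" and Z = "\<lambda>l b. Z (e l) b"])
      fix a b assume ab: "a \<in> I" "b \<in> J"
      have "A (a, b) = Y a p * Z p b + (\<Sum>l<r'. Y a (e l) * Z (e l) b)"
        using YZ[of a b] ab unfolding split by simp
      then show "A (a, b) = (\<Sum>l<r'. (Y a (e l) - Y a p * (\<phi> (e l) / \<phi> p)) * Z (e l) b)"
        by (simp add: Zp[OF ab(2)] left_diff_distrib sum_subtractf sum_distrib_left mult.assoc)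
    qed
    with min[OF r'] show thesis by blast
  qed
qed

text \<open>
  Column \<open>q\<close> is a linear combination of the columns in \<open>J\<close>, because the inner block already has full
  rank \<open>r\<close>; the same combination in row \<open>i\<close> is the entry to fill in.
\<close>

lemma rank_le_fill_corner:
  assumes "finite J" "i \<notin> I" "q \<notin> J"
    and row: "rank_le (insert i I) J r A" and col: "rank_le I (insert q J) r A"
    and min: "\<And>r'. r = Suc r' \<Longrightarrow> \<not> rank_le I J r' A"
  obtains x where "rank_le (insert i I) (insert q J) r (A((i, q) := x))"
proof -
  obtain w where w: "\<And>a. a \<in> I \<Longrightarrow> A (a, q) = (\<Sum>b\<in>J. A (a, b) * w b)"
    using column_in_span[OF assms(1) col min] by blast
  obtain Y Z where YZ: "\<And>a b. a \<in> insert i I \<Longrightarrow> b \<in> J \<Longrightarrow> A (a, b) = (\<Sum>l<r. Y a l * Z l b)"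
    using row unfolding rank_le_def by blast
  have *: "(\<Sum>b\<in>J. A (a, b) * w b) = (\<Sum>l<r. Y a l * (\<Sum>b\<in>J. Z l b * w b))" if "a \<in> insert i I" for a
  proof -
    have "(\<Sum>b\<in>J. A (a, b) * w b) = (\<Sum>b\<in>J. \<Sum>l<r. Y a l * (Z l b * w b))"
      by (rule sum.cong) (simp_all add: YZ[OF that] sum_distrib_right mult.assoc)
    also have "\<dots> = (\<Sum>l<r. \<Sum>b\<in>J. Y a l * (Z l b * w b))" by (rule sum.swap)
    finally show ?thesis by (simp add: sum_distrib_left)
  qed
  have "rank_le (insert i I) (insert q J) r (A((i, q) := \<Sum>b\<in>J. A (i, b) * w b))" (is "rank_le _ _ _ ?A")
  proof (rule rank_leI[where Y = Y and Z = "\<lambda>l b. if b = q then \<Sum>b\<in>J. Z l b * w b else Z l b"])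
    fix a b assume a: "a \<in> insert i I" and b: "b \<in> insert q J"
    show "?A (a, b) = (\<Sum>l<r. Y a l * (if b = q then \<Sum>b\<in>J. Z l b * w b else Z l b))"
    proof (cases "b = q")
      case True
      have "?A (a, q) = (\<Sum>b\<in>J. A (a, b) * w b)"
        using a w by (cases "a = i") auto
      with *[OF a] True show ?thesis by simp
    next
      case False
      with b YZ[OF a, of b] show ?thesis by simp
    qed
  qed
  then show thesis by (rule that)
qed

text \<open>
  The Schur complement of the pivot \<open>inverse u\<close> at \<open>(i, q)\<close> in \<open>A'\<close> is the block of \<open>A\<close>, so the pivot
  adds just one to the rank.
\<close>

lemma rank_le_pivot:
  assumes "rank_le I J r A" "i \<notin> I" "q \<notin> J" "u \<noteq> 0"
    and A': "A' (i, q) = inverse u" "\<And>b. b \<in> J \<Longrightarrow> A' (i, b) = A (i, b)"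
      "\<And>a. a \<in> I \<Longrightarrow> A' (a, q) = A (a, q)"
      "\<And>a b. a \<in> I \<Longrightarrow> b \<in> J \<Longrightarrow> A' (a, b) = A (a, b) + u * (A (a, q) * A (i, b))"
  shows "rank_le (insert i I) (insert q J) (Suc r) A'"
proof -
  obtain Y Z where YZ: "\<And>a b. a \<in> I \<Longrightarrow> b \<in> J \<Longrightarrow> A (a, b) = (\<Sum>l<r. Y a l * Z l b)"
    using assms(1) unfolding rank_le_def by blast
  let ?Y = "\<lambda>a l. if l < r then (if a = i then 0 else Y a l) else if a = i then 1 else u * A (a, q)"
  let ?Z = "\<lambda>l b. if l < r then (if b = q then 0 else Z l b) else if b = q then inverse u else A (i, b)"
  show ?thesis
  proof (rule rank_leI[where Y = ?Y and Z = ?Z])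
    fix a b assume a: "a \<in> insert i I" and b: "b \<in> insert q J"
    show "A' (a, b) = (\<Sum>l<Suc r. ?Y a l * ?Z l b)"
    proof (cases "a = i \<or> b = q")
      case True
      then have "(\<Sum>l<r. ?Y a l * ?Z l b) = 0" by (intro sum.neutral) auto
      with True a b A' assms(2-4) show ?thesis by (auto simp: field_simps)
    next
      case False
      with a b have "a \<in> I" "b \<in> J" by auto
      with False show ?thesis by (simp add: YZ A'(4) mult.assoc)
    qed
  qed
qed

lemma rank_le_no_columns: "rank_le I {} r A"
  by (simp add: rank_le_def)

section \<open>Evaluation of polynomials at matrices\<close>

definition mon_value :: "(nat \<times> nat \<Rightarrow> 'l::field) \<Rightarrow> monom \<Rightarrow> 'l" where
  "mon_value A t = (\<Prod>x \<in> keys t. A x ^ lookup t x)"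

text \<open>
  The value at a matrix over an extension field, with \<open>h\<close> the embedding of the coefficients.
\<close>

definition ev :: "('k::field \<Rightarrow> 'l::field) \<Rightarrow> (nat \<times> nat \<Rightarrow> 'l) \<Rightarrow> 'k mpoly \<Rightarrow> 'l" where
  "ev h A f = (\<Sum>t \<in> keys f. h (lookup f t) * mon_value A t)"

lemma mon_value_superset:
  assumes "finite X" "keys t \<subseteq> X"
  shows "mon_value A t = (\<Prod>x \<in> X. A x ^ lookup t x)"
  unfolding mon_value_def using assms
  by (intro prod.mono_neutral_left) (auto simp: in_keys_iff)

lemma mon_value_add: "mon_value A (s + t) = mon_value A s * mon_value A t"
proof -
  let ?X = "keys s \<union> keys t"
  have "mon_value A (s + t) = (\<Prod>x \<in> ?X. A x ^ lookup (s + t) x)"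
    by (rule mon_value_superset) (use keys_add[of s t] in auto)
  also have "\<dots> = (\<Prod>x \<in> ?X. A x ^ lookup s x) * (\<Prod>x \<in> ?X. A x ^ lookup t x)"
    by (simp add: lookup_add power_add prod.distrib)
  also have "\<dots> = mon_value A s * mon_value A t"
    by (simp add: mon_value_superset[of ?X])
  finally show ?thesis .
qed

lemma comm_ring_hom_ev:
  fixes h :: "'k::field \<Rightarrow> 'l::field"
  assumes h: "comm_ring_hom h"
  shows "comm_ring_hom (ev h A)"
proof -
  interpret comm_ring_hom h by (rule h)
  have sup: "ev h A f = (\<Sum>t \<in> S. h (lookup f t) * mon_value A t)"
    if "finite S" "keys f \<subseteq> S" for f S
    unfolding ev_def using that by (intro sum.mono_neutral_left) (auto simp: in_keys_iff)
  have add: "ev h A (f + g) = ev h A f + ev h A g" for f g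
  proof -
    let ?S = "keys f \<union> keys g"
    have "ev h A (f + g) = (\<Sum>t \<in> ?S. h (lookup (f + g) t) * mon_value A t)"
      by (rule sup) (use keys_add[of f g] in auto)
    also have "\<dots> = (\<Sum>t \<in> ?S. h (lookup f t) * mon_value A t) + (\<Sum>t \<in> ?S. h (lookup g t) * mon_value A t)"
      by (simp add: lookup_add hom_add distrib_right sum.distrib)
    also have "\<dots> = ev h A f + ev h A g" by (simp add: sup[of ?S])
    finally show ?thesis .
  qed
  have zero: "ev h A 0 = 0" by (simp add: ev_def)
  have one: "ev h A 1 = 1" by (simp add: ev_def mon_value_def)
  have sum: "ev h A (sum g S) = (\<Sum>s \<in> S. ev h A (g s))" for g :: "monom \<Rightarrow> 'k mpoly" and S
    by (induction S rule: infinite_finite_induct) (simp_all add: zero add)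
  have single: "ev h A (single a c * g) = h c * mon_value A a * ev h A g" for a c g
  proof (cases "c = 0")
    case False
    then have "ev h A (single a c * g)
        = (\<Sum>t \<in> (+) a ` keys g. h (lookup (single a c * g) t) * mon_value A t)"
      by (simp add: ev_def keys_single_times)
    also have "\<dots> = (\<Sum>t \<in> keys g. h (lookup (single a c * g) (a + t)) * mon_value A (a + t))"
      by (subst sum.reindex) (auto simp: inj_on_def)
    also have "\<dots> = (\<Sum>t \<in> keys g. h c * mon_value A a * (h (lookup g t) * mon_value A t))"
      by (simp add: lookup_single_times mon_value_add hom_mult) (simp only: mult_ac)
    also have "\<dots> = h c * mon_value A a * ev h A g"
      by (simp add: ev_def sum_distrib_left)
    finally show ?thesis .
  qed (simp add: zero)
  have mult: "ev h A (f * g) = ev h A f * ev h A g" for f g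
  proof -
    have "f * g = (\<Sum>t \<in> keys f. single t (lookup f t) * g)"
      by (subst poly_mapping_sum_single[of f]) (simp add: sum_distrib_right)
    then have "ev h A (f * g) = (\<Sum>t \<in> keys f. h (lookup f t) * mon_value A t * ev h A g)"
      by (simp add: sum single)
    also have "\<dots> = ev h A f * ev h A g" by (simp add: ev_def sum_distrib_right)
    finally show ?thesis .
  qed
  show ?thesis by unfold_locales (rule add mult zero one)+
qed

section \<open>Leading monomials of minors\<close>

text \<open>
  The positions of the variables on the main diagonal of a minor.
\<close>

definition diag :: "nat set \<Rightarrow> nat set \<Rightarrow> (nat \<times> nat) set" where
  "diag A B = set (zip (sorted_list_of_set A) (sorted_list_of_set B))"

lemma lookup_sum_single:
  assumes "finite I" "inj_on g I"
  shows "lookup (\<Sum>i \<in> I. single (g i) (1::nat)) x = (if x \<in> g ` I then 1 else 0)"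
proof -
  have "lookup (\<Sum>i \<in> I. single (g i) (1::nat)) x = (\<Sum>y \<in> g ` I. if y = x then 1 else 0)"
    using assms(2) by (simp add: lookup_sum lookup_single when_def sum.reindex del: One_nat_def)
  also have "\<dots> = (if x \<in> g ` I then 1 else 0)" using assms(1) by simp
  finally show ?thesis .
qed

lemma minor_expansion:
  fixes A B :: "nat set"
  assumes k: "card A = k" "card B = k"
  defines "a \<equiv> sorted_list_of_set A" and "b \<equiv> sorted_list_of_set B"
  shows "(minor A B :: 'k::field mpoly) = (\<Sum>p | p permutes {0..<k}.
      single (\<Sum>i = 0..<k. single (a ! i, b ! p i) 1) (signof p))"
proof -
  let ?f = "\<lambda>(p, q). var (a ! p) (b ! q) :: 'k mpoly"
  have prod_single: "(\<Prod>i \<in> I. single (g i) (1 :: 'k)) = single (\<Sum>i \<in> I. g i) 1"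
    for g :: "nat \<Rightarrow> monom" and I
    by (induction I rule: infinite_finite_induct) (simp_all add: mult_single)
  have "signof p * (\<Prod>i = 0..<k. mat k k ?f $$ (i, p i))
      = single (\<Sum>i = 0..<k. single (a ! i, b ! p i) 1) (signof p)"
    if p: "p permutes {0..<k}" for p
  proof -
    have "(\<Prod>i = 0..<k. mat k k ?f $$ (i, p i)) = (\<Prod>i = 0..<k. single (single (a ! i, b ! p i) 1) (1 :: 'k))"
    proof (rule prod.cong[OF refl])
      fix i assume i: "i \<in> {0..<k}"
      then have "p i \<in> {0..<k}" using permutes_in_image[OF p] by blast
      with i show "mat k k ?f $$ (i, p i) = single (single (a ! i, b ! p i) 1) 1"
        by (simp add: var_def)
    qed
    moreover have "(signof p :: 'k mpoly) = single 0 (signof p)"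
      by (simp add: sign_def single_uminus)
    ultimately have "signof p * (\<Prod>i = 0..<k. mat k k ?f $$ (i, p i))
        = single 0 (signof p) * single (\<Sum>i = 0..<k. single (a ! i, b ! p i) 1) 1"
      by (simp only: prod_single)
    then show ?thesis by (simp only: mult_single add_0 mult_1_right)
  qed
  then show ?thesis
    unfolding minor_def det_def k a_def[symmetric] b_def[symmetric] by simp
qed

text \<open>
  At the first row that \<open>p\<close> moves, it picks a column further to the right, hence a smaller variable.
\<close>

lemma diagonal_term_largest:
  fixes a b :: "nat list"
  assumes a: "sorted_wrt (<) a" "length a = k" and b: "sorted_wrt (<) b" "length b = k"
    and p: "p permutes {0..<k}" "p \<noteq> id"
  shows "(\<Sum>i = 0..<k. single (a ! i, b ! p i) (1::nat)) < (\<Sum>i = 0..<k. single (a ! i, b ! i) 1)"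
    (is "?s < ?t")
proof -
  have a_less: "a ! i < a ! j" if "i < j" "j < k" for i j
    using sorted_wrt_nth_less[OF a(1) that(1)] that(2) a(2) by simp
  have b_less: "b ! i < b ! j" if "i < j" "j < k" for i j
    using sorted_wrt_nth_less[OF b(1) that(1)] that(2) b(2) by simp
  have a_eq: "a ! i = a ! j \<longleftrightarrow> i = j" if "i < k" "j < k" for i j
    using a_less[of i j] a_less[of j i] that by (cases i j rule: linorder_cases) auto
  have b_eq: "b ! i = b ! j \<longleftrightarrow> i = j" if "i < k" "j < k" for i j
    using b_less[of i j] b_less[of j i] that by (cases i j rule: linorder_cases) auto
  have lookup: "lookup (\<Sum>i = 0..<k. single (a ! i, b ! q i) (1::nat)) x
      = (if x \<in> (\<lambda>i. (a ! i, b ! q i)) ` {0..<k} then 1 else 0)" for q x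
    by (rule lookup_sum_single) (auto simp: inj_on_def a_eq)
  have fix_ge: "p i = i" if "\<not> i < k" for i
    using permutes_not_in[OF p(1)] that by simp
  obtain i0 where "p i0 \<noteq> i0" using p(2) by (auto simp: fun_eq_iff)
  define i where "i = (LEAST i. p i \<noteq> i)"
  have i: "p i \<noteq> i" unfolding i_def by (rule LeastI) (rule \<open>p i0 \<noteq> i0\<close>)
  have below: "p j = j" if "j < i" for j using not_less_Least that unfolding i_def by blast
  have ik: "i < k" using i fix_ge by blast
  have pk: "p i < k" using permutes_in_image[OF p(1), of i] ik by simp
  have pi: "i < p i"
  proof (rule ccontr)
    assume "\<not> i < p i"
    then have "p (p i) = p i" using i by (intro below) simp
    then have "p i = i" using permutes_inj[OF p(1)] by (simp add: inj_eq)
    with i show False ..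
  qed
  have "lookup ?s (a ! i, b ! i) = 0"
  proof -
    have "(a ! i, b ! i) \<notin> (\<lambda>i. (a ! i, b ! p i)) ` {0..<k}"
      using ik pk pi b_eq a_eq by (auto simp: image_iff)
    then show ?thesis using lookup[of p] by simp
  qed
  moreover have "lookup ?t (a ! i, b ! i) = 1"
    using lookup[of "\<lambda>i. i"] ik by auto
  moreover have "lookup ?s x = lookup ?t x" if x: "x < (a ! i, b ! i)" for x
  proof -
    have "x \<in> (\<lambda>i. (a ! i, b ! p i)) ` {0..<k} \<longleftrightarrow> x \<in> (\<lambda>i. (a ! i, b ! i)) ` {0..<k}"
    proof -
      have 1: "j < i" if "j < k" "x = (a ! j, b ! p j)" for j
      proof (rule ccontr)
        assume "\<not> j < i"
        then consider "j = i" | "i < j" by linarith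
        then show False
          using x that a_less[of i j] b_less[OF pi pk] by cases (auto simp: less_prod_def)
      qed
      have 2: "j < i" if "j < k" "x = (a ! j, b ! j)" for j
      proof (rule ccontr)
        assume "\<not> j < i"
        then consider "j = i" | "i < j" by linarith
        then show False
          using x that a_less[of i j] by cases (auto simp: less_prod_def)
      qed
      show ?thesis
      proof
        assume "x \<in> (\<lambda>i. (a ! i, b ! p i)) ` {0..<k}"
        then obtain j where j: "j < k" "x = (a ! j, b ! p j)" by auto
        with below[OF 1[OF j]] show "x \<in> (\<lambda>i. (a ! i, b ! i)) ` {0..<k}" by auto
      next
        assume "x \<in> (\<lambda>i. (a ! i, b ! i)) ` {0..<k}"
        then obtain j where j: "j < k" "x = (a ! j, b ! j)" by auto
        then have "x = (a ! j, b ! p j)" using below[OF 2[OF j]] by simp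
        with j(1) show "x \<in> (\<lambda>i. (a ! i, b ! p i)) ` {0..<k}" by auto
      qed
    qed
    then show ?thesis using lookup[of p] lookup[of "\<lambda>i. i"] by simp
  qed
  ultimately show ?thesis
    unfolding less_poly_mapping.rep_eq less_fun_def by (intro exI[of _ "(a ! i, b ! i)"]) simp
qed

text \<open>
  The exponent of the diagonal is attained by the identity permutation alone, so no cancellation
  occurs there and the coefficient is 1.
\<close>

lemma lm_minor:
  fixes A B :: "nat set"
  assumes fin: "finite A" "finite B" and card: "card A = card B"
  shows "lookup (lm (minor A B :: 'k::field mpoly)) x = (if x \<in> diag A B then 1 else 0)"
    and "lookup (minor A B :: 'k mpoly) (lm (minor A B :: 'k mpoly)) = 1"
proof -
  define k where "k = card A"
  define a where "a = sorted_list_of_set A"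
  define b where "b = sorted_list_of_set B"
  have a: "sorted_wrt (<) a" "length a = k" and b: "sorted_wrt (<) b" "length b = k"
    using card by (simp_all add: a_def b_def k_def)
  let ?P = "{p. p permutes {0..<k}}"
  let ?s = "\<lambda>p :: nat \<Rightarrow> nat. \<Sum>i = 0..<k. single (a ! i, b ! p i) (1::nat)"
  have finP: "finite ?P" by (rule finite_permutations) simp
  have M: "(minor A B :: 'k mpoly) = (\<Sum>p \<in> ?P. single (?s p) (signof p))"
    unfolding a_def b_def by (rule minor_expansion) (simp_all add: k_def card)
  have less: "?s p < ?s id" if "p \<in> ?P" "p \<noteq> id" for p
    using diagonal_term_largest[OF a b, of p] that by simp
  have "lookup (minor A B :: 'k mpoly) (?s id) = (\<Sum>p \<in> ?P. if p = id then 1 else 0)"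
    unfolding M lookup_sum
  proof (rule sum.cong[OF refl])
    fix p assume p: "p \<in> ?P"
    show "lookup (single (?s p) (signof p :: 'k)) (?s id) = (if p = id then 1 else 0)"
    proof (cases "p = id")
      case False
      have "?s p \<noteq> ?s id" using less[OF p False] by (rule less_imp_neq)
      then show ?thesis using False by (simp add: lookup_single_not_eq)
    qed simp
  qed
  also have "\<dots> = 1" using finP by (simp add: permutes_id)
  finally have one: "lookup (minor A B :: 'k mpoly) (?s id) = 1" .
  have lm: "lm (minor A B :: 'k mpoly) = ?s id"
  proof (rule lm_unique)
    show "?s id \<in> keys (minor A B :: 'k mpoly)" unfolding in_keys_iff one by simp
    fix u assume "u \<in> keys (minor A B :: 'k mpoly)"
    then obtain p where "p \<in> ?P" "u \<in> keys (single (?s p) (signof p :: 'k))"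
      using keys_sum[of "\<lambda>p. single (?s p) (signof p :: 'k)" ?P] unfolding M by blast
    then have "p \<in> ?P" "u = ?s p" by (auto split: if_splits)
    then show "u \<le> ?s id" using less[of p] by (cases "p = id") auto
  qed
  show "lookup (minor A B :: 'k mpoly) (lm (minor A B :: 'k mpoly)) = 1"
    unfolding lm by (rule one)
  have "inj_on (\<lambda>i. (a ! i, b ! i)) {0..<k}"
    using a by (auto simp: inj_on_def strict_sorted_iff nth_eq_iff_index_eq)
  moreover have "(\<lambda>i. (a ! i, b ! i)) ` {0..<k} = diag A B"
    using a b by (auto simp: diag_def a_def[symmetric] b_def[symmetric] set_zip)
  ultimately show "lookup (lm (minor A B :: 'k mpoly)) x = (if x \<in> diag A B then 1 else 0)"
    unfolding lm using lookup_sum_single[of "{0..<k}" "\<lambda>i. (a ! i, b ! i)" x] by simp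
qed

text \<open>
  The evaluated submatrix is a product of two square matrices whose inner dimension is padded from \<open>r\<close>
  to \<open>r + 1\<close> by zeros; the second factor has a zero row.
\<close>

lemma minor_vanishes:
  fixes E :: "'k::field mpoly \<Rightarrow> 'l::field"
  assumes E: "comm_ring_hom E" and var: "\<And>i j. E (var i j) = M (i, j)"
    and M: "rank_le I J r M" and AB: "A \<subseteq> I" "B \<subseteq> J" "finite A" "finite B"
    and card: "card A = Suc r" "card B = Suc r"
  shows "E (minor A B) = 0"
proof -
  interpret comm_ring_hom E by (rule E)
  obtain Y Z where YZ: "\<And>a b. a \<in> I \<Longrightarrow> b \<in> J \<Longrightarrow> M (a, b) = (\<Sum>l<r. Y a l * Z l b)"
    using M unfolding rank_le_def by blast
  define k where "k = Suc r"
  define a where "a = sorted_list_of_set A"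
  define b where "b = sorted_list_of_set B"
  define P where "P = mat k k (\<lambda>(p, l). if l < r then Y (a ! p) l else 0)"
  define Q where "Q = mat k k (\<lambda>(l, q). if l < r then Z l (b ! q) else 0)"
  have PQ: "P \<in> carrier_mat k k" "Q \<in> carrier_mat k k" by (simp_all add: P_def Q_def)
  have ab: "a ! p \<in> I" "b ! p \<in> J" if "p < k" for p
    using nth_mem[of p a] nth_mem[of p b] that AB card by (auto simp: a_def b_def k_def)
  have "map_mat E (mat k k (\<lambda>(p, q). var (a ! p) (b ! q))) = P * Q"
  proof (rule eq_matI)
    fix p q assume "p < dim_row (P * Q)" "q < dim_col (P * Q)"
    then have pq: "p < k" "q < k" by (simp_all add: P_def Q_def)
    have "(P * Q) $$ (p, q) = (\<Sum>l = 0..<k. P $$ (p, l) * Q $$ (l, q))"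
      using pq PQ by (simp add: scalar_prod_def)
    also have "\<dots> = (\<Sum>l<k. (if l < r then Y (a ! p) l else 0) * (if l < r then Z l (b ! q) else 0))"
      unfolding atLeast0LessThan by (rule sum.cong) (use pq in \<open>simp_all add: P_def Q_def\<close>)
    also have "\<dots> = (\<Sum>l<r. Y (a ! p) l * Z l (b ! q))"
      by (simp add: k_def)
    also have "\<dots> = M (a ! p, b ! q)" using YZ ab pq by simp
    finally show "map_mat E (mat k k (\<lambda>(p, q). var (a ! p) (b ! q))) $$ (p, q) = (P * Q) $$ (p, q)"
      using pq by (simp add: var)
  qed (simp_all add: P_def Q_def)
  moreover have "det Q = 0"
    unfolding det_def'[OF PQ(2)]
  proof (rule sum.neutral, rule ballI)
    fix p assume "p \<in> {p. p permutes {0..<k}}"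
    then have "p r < k" using permutes_in_image[of p "{0..<k}" r] by (simp add: k_def)
    then have "Q $$ (r, p r) = 0" by (simp add: Q_def k_def)
    then have "(\<Prod>i = 0..<k. Q $$ (i, p i)) = 0"
      by (intro prod_zero) (auto simp: k_def intro!: bexI[of _ r])
    then show "signof p * (\<Prod>i = 0..<k. Q $$ (i, p i)) = 0" by simp
  qed
  ultimately have "det (map_mat E (mat k k (\<lambda>(p, q). var (a ! p) (b ! q)))) = 0"
    by (simp add: det_mult[OF PQ])
  then show ?thesis
    unfolding hom_det minor_def card k_def a_def b_def .
qed

section \<open>Chains\<close>

definition chain :: "(nat \<times> nat) set \<Rightarrow> bool" where
  "chain C \<longleftrightarrow> (\<forall>x \<in> C. \<forall>y \<in> C. x \<noteq> y \<longrightarrow>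
     fst x < fst y \<and> snd x < snd y \<or> fst y < fst x \<and> snd y < snd x)"

definition chain_length :: "(nat \<times> nat) set \<Rightarrow> nat \<Rightarrow> nat \<Rightarrow> nat" where
  "chain_length S i j = Max (card ` {C. C \<subseteq> {x \<in> S. fst x < i \<and> snd x < j} \<and> chain C})"

context
  fixes S :: "(nat \<times> nat) set"
  assumes fin: "finite S"
begin

lemma finite_chains: "finite (card ` {C. C \<subseteq> {x \<in> S. fst x < i \<and> snd x < j} \<and> chain C})"
  by (rule finite_imageI, rule finite_subset[of _ "Pow S"]) (use fin in auto)

lemma chain_length_ge:
  assumes "C \<subseteq> {x \<in> S. fst x < i \<and> snd x < j}" "chain C"
  shows "card C \<le> chain_length S i j"
  unfolding chain_length_def by (rule Max_ge[OF finite_chains]) (use assms in blast)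

lemma chain_length_attained:
  obtains C where "C \<subseteq> {x \<in> S. fst x < i \<and> snd x < j}" "chain C" "card C = chain_length S i j"
proof -
  have "{} \<in> {C. C \<subseteq> {x \<in> S. fst x < i \<and> snd x < j} \<and> chain C}" by (simp add: chain_def)
  then have "card ` {C. C \<subseteq> {x \<in> S. fst x < i \<and> snd x < j} \<and> chain C} \<noteq> {}" by blast
  from Max_in[OF finite_chains this]
  have "chain_length S i j \<in> card ` {C. C \<subseteq> {x \<in> S. fst x < i \<and> snd x < j} \<and> chain C}"
    unfolding chain_length_def .
  then show thesis
  proof (rule imageE)
    fix C assume "chain_length S i j = card C" "C \<in> {C. C \<subseteq> {x \<in> S. fst x < i \<and> snd x < j} \<and> chain C}"
    then show thesis by (intro that[of C]) simp_all
  qed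
qed

lemma chain_length_mono:
  assumes "i \<le> i'" "j \<le> j'"
  shows "chain_length S i j \<le> chain_length S i' j'"
proof -
  obtain C where C: "C \<subseteq> {x \<in> S. fst x < i \<and> snd x < j}" "chain C" "card C = chain_length S i j"
    by (rule chain_length_attained)
  have "C \<subseteq> {x \<in> S. fst x < i' \<and> snd x < j'}" using C(1) assms by fastforce
  from chain_length_ge[OF this C(2)] C(3) show ?thesis by simp
qed

lemma chain_length_step:
  assumes "(i, j) \<in> S"
  shows "Suc (chain_length S i j) \<le> chain_length S (Suc i) (Suc j)"
proof -
  obtain C where C: "C \<subseteq> {x \<in> S. fst x < i \<and> snd x < j}" "chain C" "card C = chain_length S i j"
    by (rule chain_length_attained)
  have "finite C" by (rule finite_subset[OF _ fin]) (use C(1) in auto)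
  moreover have "(i, j) \<notin> C" using C(1) by auto
  ultimately have "card (insert (i, j) C) = Suc (chain_length S i j)" using C(3) by simp
  moreover have "chain (insert (i, j) C)" using C(1,2) by (fastforce simp: chain_def)
  moreover have "insert (i, j) C \<subseteq> {x \<in> S. fst x < Suc i \<and> snd x < Suc j}"
    using C(1) assms by fastforce
  ultimately show ?thesis using chain_length_ge[of "insert (i, j) C" "Suc i" "Suc j"] by simp
qed

end

lemma chain_subset: "chain C \<Longrightarrow> C' \<subseteq> C \<Longrightarrow> chain C'"
  unfolding chain_def by blast

text \<open>
  A chain is recovered from its sets of rows and columns, because sorting it by rows sorts it by columns
  as well; so chains are the same as diagonals of minors.
\<close>

lemma chain_is_diagonal:
  assumes fin: "finite C" and C: "chain C"
  shows "card (fst ` C) = card C" "card (snd ` C) = card C" "diag (fst ` C) (snd ` C) = C"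
proof -
  define cs where "cs = sorted_list_of_set C"
  have cs: "sorted_wrt (<) cs" "set cs = C" using fin by (simp_all add: cs_def)
  have less: "fst x < fst y \<and> snd x < snd y" if "x \<in> C" "y \<in> C" "x < y" for x y
    using C that unfolding chain_def less_prod_def by fastforce
  have f: "sorted_wrt (<) (map fst cs)"
    unfolding sorted_wrt_map by (rule sorted_wrt_mono_rel[OF _ cs(1)]) (use less cs(2) in blast)
  have s: "sorted_wrt (<) (map snd cs)"
    unfolding sorted_wrt_map by (rule sorted_wrt_mono_rel[OF _ cs(1)]) (use less cs(2) in blast)
  have inj: "inj_on fst C" "inj_on snd C"
    using C unfolding inj_on_def chain_def by (metis less_irrefl)+
  then show c: "card (fst ` C) = card C" "card (snd ` C) = card C"
    by (simp_all add: card_image)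
  have "length cs = card C" by (simp add: cs_def)
  then have "sorted_list_of_set (fst ` C) = map fst cs" "sorted_list_of_set (snd ` C) = map snd cs"
    using f s cs(2) c fin by (simp_all add: sorted_list_of_set_unique[symmetric])
  then show "diag (fst ` C) (snd ` C) = C"
    by (simp add: diag_def zip_map_fst_snd cs(2))
qed

section \<open>Polynomials vanishing on the matrices of low rank\<close>

text \<open>
  The assumptions are contradictory; the locale carries the proof by contradiction that the leading
  monomial of \<open>f\<close> contains a chain of \<open>r + 1\<close> variables with columns in \<open>T\<close>.
\<close>

locale vanishing_on_low_rank =
  fixes h :: "'k::field \<Rightarrow> 'l::field" and f :: "'k mpoly" and m n r :: nat and T :: "nat set"
  assumes infinite_field: "infinite (UNIV :: 'l set)"
    and hom: "comm_ring_hom h"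
    and f_carrier: "f \<in> carrier (KX m n)" and f_nonzero: "f \<noteq> 0"
    and T_range: "T \<subseteq> {1..n}"
    and vanishes: "\<And>A. rank_le {1..m} T r A \<Longrightarrow> ev h A f = 0"
    and chains: "\<And>C. C \<subseteq> keys (lm f) \<Longrightarrow> snd ` C \<subseteq> T \<Longrightarrow> chain C \<Longrightarrow> card C \<le> r"
begin

interpretation comm_ring_hom h by (rule hom)

abbreviation X :: "(nat \<times> nat) set" where "X \<equiv> {1..m} \<times> {1..n}"

definition agreeing :: "(nat \<times> nat) set \<Rightarrow> monom set" where
  "agreeing U = {t \<in> keys f. \<forall>x \<in> U. lookup t x = lookup (lm f) x}"

text \<open>
  The value at \<open>A\<close> of the coefficient in \<open>f\<close> of the part of \<open>lm f\<close> supported on \<open>U\<close>, where \<open>f\<close> is read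
  as a polynomial in the variables \<open>U\<close>. For \<open>U\<close> empty this is the value of \<open>f\<close>, and for \<open>U = X\<close> it is
  the image of the leading coefficient under \<open>h\<close>.
\<close>

definition front :: "(nat \<times> nat) set \<Rightarrow> (nat \<times> nat \<Rightarrow> 'l) \<Rightarrow> 'l" where
  "front U A = (\<Sum>t \<in> agreeing U. h (lookup f t) * (\<Prod>x \<in> X - U. A x ^ lookup t x))"

definition before :: "nat \<Rightarrow> nat \<Rightarrow> (nat \<times> nat) set" where
  "before i q = {x \<in> X. x < (i, q)}"

definition depth :: "nat \<Rightarrow> nat \<Rightarrow> nat" where
  "depth = chain_length {x \<in> keys (lm f). snd x \<in> T}"

lemma depth_mono: "i \<le> i' \<Longrightarrow> j \<le> j' \<Longrightarrow> depth i j \<le> depth i' j'"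
  unfolding depth_def by (rule chain_length_mono) simp_all

lemma depth_step: "(i, j) \<in> keys (lm f) \<Longrightarrow> j \<in> T \<Longrightarrow> Suc (depth i j) \<le> depth (Suc i) (Suc j)"
  unfolding depth_def by (rule chain_length_step) simp_all

lemma depth_le: "depth i j \<le> r"
proof -
  obtain C where "C \<subseteq> {x \<in> {x \<in> keys (lm f). snd x \<in> T}. fst x < i \<and> snd x < j}" "chain C"
    "card C = depth i j"
    unfolding depth_def by (rule chain_length_attained[of "{x \<in> keys (lm f). snd x \<in> T}"]) simp_all
  then show ?thesis using chains[of C] by auto
qed

text \<open>
  The bounds in force when the entries before \<open>(i, q)\<close> have been removed. A block that reaches up to row
  \<open>i\<close> can only start at a column \<open>j \<ge> q\<close>. The blocks below row \<open>i\<close> are bounded only for \<open>j \<le> q\<close>: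
  those further to the right are altered when the entry \<open>(i, q)\<close> is sent to infinity.
\<close>

definition rank_conditions :: "nat \<Rightarrow> nat \<Rightarrow> (nat \<times> nat \<Rightarrow> 'l) \<Rightarrow> bool" where
  "rank_conditions i q A \<longleftrightarrow>
     (\<forall>j \<ge> q. rank_le {i..m} {b \<in> T. j \<le> b} (r - depth i j) A) \<and>
     (\<forall>j \<ge> 1. j \<le> q \<longrightarrow> rank_le {i<..m} {b \<in> T. j \<le> b} (r - depth (Suc i) j) A)"

text \<open>
  The order is lexicographic: the monomials that agree with \<open>lm f\<close> before \<open>w\<close> have at most its exponent
  at \<open>w\<close>.
\<close>

lemma exponent_le:
  assumes "t \<in> agreeing {x \<in> X. x < w}"
  shows "lookup t w \<le> lookup (lm f) w"
proof (rule ccontr)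
  assume c: "\<not> lookup t w \<le> lookup (lm f) w"
  have t: "t \<in> keys f" "\<And>x. x \<in> X \<Longrightarrow> x < w \<Longrightarrow> lookup t x = lookup (lm f) x"
    using assms by (auto simp: agreeing_def)
  have kt: "keys t \<subseteq> X" using t(1) f_carrier by (auto simp: KX_carrier_iff)
  have kf: "keys (lm f) \<subseteq> X" by (rule lm_keys_subset[OF f_carrier f_nonzero])
  have "lookup t x = lookup (lm f) x" if "x < w" for x
  proof (cases "x \<in> X")
    case False
    then have "x \<notin> keys t" "x \<notin> keys (lm f)" using kt kf by blast+
    then show ?thesis by (simp add: in_keys_iff)
  qed (use t(2) that in blast)
  then have "lm f < t" using c unfolding less_poly_mapping.rep_eq less_fun_def
    by (intro exI[of _ w]) (simp add: not_le)
  with lm_ge[OF t(1)] show False by simp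
qed

lemma agreeing_insert:
  "agreeing (insert w U) = {t \<in> agreeing U. lookup t w = lookup (lm f) w}"
  by (auto simp: agreeing_def)

lemma finite_agreeing: "finite (agreeing U)"
  by (simp add: agreeing_def)

text \<open>
  The entry \<open>w\<close> tends to infinity as \<open>inverse u\<close> with \<open>u \<rightarrow> 0\<close>, while the later entries move along \<open>D\<close>.
  After multiplication by the power of \<open>u\<close> with the exponent of \<open>w\<close> in \<open>lm f\<close>, the value is a polynomial
  in \<open>u\<close> with zeros at all \<open>u \<noteq> 0\<close>; over an infinite field it vanishes at \<open>u = 0\<close> too, and there only the leading
  coefficient in the variable \<open>w\<close> survives.
\<close>

lemma front_limit:
  fixes A D :: "nat \<times> nat \<Rightarrow> 'l"
  assumes w: "w \<in> X"
    and zero: "\<And>u. u \<noteq> 0 \<Longrightarrow> front {x \<in> X. x < w} ((\<lambda>x. A x + u * D x)(w := inverse u)) = 0"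
  shows "front (insert w {x \<in> X. x < w}) A = 0"
proof -
  define U where "U = {x \<in> X. x < w}"
  define W where "W = X - insert w U"
  define e where "e = lookup (lm f) w"
  have XU: "X - U = insert w W" "w \<notin> W" "finite W" using w by (auto simp: U_def W_def)
  have le: "lookup t w \<le> e" if "t \<in> agreeing U" for t
    using exponent_le[of t w] that by (simp add: U_def e_def)
  define P where "P = (\<Sum>t \<in> agreeing U. [:h (lookup f t):] * monom 1 (e - lookup t w) *
      (\<Prod>x \<in> W. [:A x, D x:] ^ lookup t x))"
  have P: "poly P u = (\<Sum>t \<in> agreeing U. h (lookup f t) * u ^ (e - lookup t w) *
      (\<Prod>x \<in> W. (A x + u * D x) ^ lookup t x))" for u
    by (simp add: P_def poly_sum poly_prod poly_monom mult.assoc)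
  have "poly P u = 0" if u: "u \<noteq> 0" for u
  proof -
    let ?A = "(\<lambda>x. A x + u * D x)(w := inverse u)"
    have "h (lookup f t) * u ^ (e - lookup t w) * (\<Prod>x \<in> W. (A x + u * D x) ^ lookup t x)
        = u ^ e * (h (lookup f t) * (\<Prod>x \<in> X - U. ?A x ^ lookup t x))"
      if t: "t \<in> agreeing U" for t
    proof -
      have "(\<Prod>x \<in> X - U. ?A x ^ lookup t x)
          = inverse u ^ lookup t w * (\<Prod>x \<in> W. ?A x ^ lookup t x)"
        unfolding XU(1) using XU(2,3) by (simp add: prod.insert)
      also have "(\<Prod>x \<in> W. ?A x ^ lookup t x) = (\<Prod>x \<in> W. (A x + u * D x) ^ lookup t x)"
        using XU(2) by (intro prod.cong) auto
      finally have "(\<Prod>x \<in> X - U. ?A x ^ lookup t x)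
          = inverse u ^ lookup t w * (\<Prod>x \<in> W. (A x + u * D x) ^ lookup t x)" .
      moreover have "u ^ e * inverse u ^ lookup t w = u ^ (e - lookup t w)"
        using le[OF t] u by (simp add: power_diff power_inverse divide_inverse)
      ultimately show ?thesis by (simp add: mult_ac)
    qed
    then have "poly P u = u ^ e * front U ?A"
      unfolding P front_def sum_distrib_left by (rule sum.cong[OF refl])
    then show ?thesis using zero[OF u] by (simp add: U_def)
  qed
  then have "{u. u \<noteq> 0} \<subseteq> {u. poly P u = 0}" by blast
  moreover have "infinite {u :: 'l. u \<noteq> 0}"
  proof -
    have "(UNIV :: 'l set) = insert 0 {u. u \<noteq> 0}" by blast
    then show ?thesis using infinite_field by (metis finite_insert)
  qed
  ultimately have "P = 0" using poly_roots_finite[of P] finite_subset by blast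
  then have "0 = poly P 0" by simp
  also have "\<dots> = (\<Sum>t \<in> agreeing U. if lookup t w = e
      then h (lookup f t) * (\<Prod>x \<in> W. A x ^ lookup t x) else 0)"
    unfolding P by (rule sum.cong) (use le in \<open>force simp: power_0_left\<close>)+
  also have "\<dots> = (\<Sum>t \<in> agreeing (insert w U). h (lookup f t) * (\<Prod>x \<in> W. A x ^ lookup t x))"
    unfolding agreeing_insert e_def using finite_agreeing by (simp add: sum.inter_filter)
  also have "\<dots> = front (insert w U) A" by (simp add: front_def W_def)
  finally show ?thesis by (simp add: U_def)
qed

text \<open>
  For a matrix that satisfies the bounds after \<open>(i, q)\<close>, one has to produce matrices satisfying the
  bounds at \<open>(i, q)\<close>. Columns outside \<open>T\<close> are in no block, so their entries are free. In a column of
  \<open>T\<close>, either the block south-east of the entry has rank below \<open>r - depth i q\<close>, and the entry can be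
  sent to infinity, or the block attains this rank, and the entry can be filled in without raising the
  rank. In the second case \<open>(i, q)\<close> is not in \<open>lm f\<close>, since otherwise the longest chain would have
  grown past the entry and the bound on the block would be smaller.
\<close>

lemma front_step:
  assumes i: "1 \<le> i" "i \<le> m" and q: "1 \<le> q" "q \<le> n"
    and IH: "\<And>A. rank_conditions i q A \<Longrightarrow> front (before i q) A = 0"
    and A: "rank_conditions i (Suc q) A"
  shows "front (before i (Suc q)) A = 0"
proof -
  let ?w = "(i, q)"
  have w: "?w \<in> X" using i q by simp
  have next_front: "before i (Suc q) = insert ?w {x \<in> X. x < ?w}"
    using w by (auto simp: before_def)
  let ?I = "{i<..m}" and ?J = "\<lambda>j. {b \<in> T. j \<le> b}"
  have rows: "{i..m} = insert i ?I" using i by auto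
  have A1: "rank_le {i..m} (?J j) (r - depth i j) A" if "Suc q \<le> j" for j
    using A that by (simp add: rank_conditions_def)
  have A2: "rank_le ?I (?J j) (r - depth (Suc i) j) A" if "1 \<le> j" "j \<le> Suc q" for j
    using A that by (simp add: rank_conditions_def)
  show ?thesis
  proof (cases "q \<in> T")
    case False
    have Jq: "?J q = ?J (Suc q)" using False by (auto simp: Suc_le_eq le_less)
    show ?thesis
      unfolding next_front
    proof (rule front_limit[OF w, where D = "\<lambda>_. 0"])
      fix u :: 'l
      let ?A = "(\<lambda>x. A x + u * 0)(?w := inverse u)"
      have same: "rank_le I (?J j) \<rho> ?A" if "rank_le I (?J j) \<rho> A" for I j \<rho>
        by (rule rank_le_cong[OF that]) (use False in auto)
      have "rank_le {i..m} (?J j) (r - depth i j) ?A" if "q \<le> j" for j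
      proof (cases "j = q")
        case True
        have "r - depth i (Suc q) \<le> r - depth i q"
          using depth_mono[of i i q "Suc q"] by simp
        from rank_le_mono[OF A1[OF order_refl] this]
        have "rank_le {i..m} (?J q) (r - depth i q) A" unfolding Jq .
        then show ?thesis unfolding True by (rule same)
      next
        case False
        with that show ?thesis by (intro same A1) simp
      qed
      moreover have "rank_le ?I (?J j) (r - depth (Suc i) j) ?A" if "1 \<le> j" "j \<le> q" for j
        using that by (intro same A2) simp_all
      ultimately have "rank_conditions i q ?A" by (simp add: rank_conditions_def)
      from IH[OF this] show "front {x \<in> X. x < ?w} ?A = 0" by (simp add: before_def)
    qed
  next
    case qT: True
    have cols: "?J q = insert q (?J (Suc q))" using qT by auto
    define \<rho> where "\<rho> = r - depth i q"
    show ?thesis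
    proof (cases "\<exists>\<rho>'. \<rho> = Suc \<rho>' \<and> rank_le ?I (?J (Suc q)) \<rho>' A")
      case True
      then obtain \<rho>' where \<rho>': "\<rho> = Suc \<rho>'" "rank_le ?I (?J (Suc q)) \<rho>' A" by blast
      \<comment> \<open>The direction of the outer product that keeps the Schur complement of the entry \<open>(i, q)\<close> fixed.
        On the blocks starting right of \<open>q\<close> it acts by adding multiples of row \<open>i\<close>, and on the blocks
        below row \<open>i\<close> by adding multiples of column \<open>q\<close>.\<close>
      define D where "D = (\<lambda>(a, b). if i < a \<and> q < b then A (a, q) * A (i, b) else 0)"
      show ?thesis
        unfolding next_front
      proof (rule front_limit[OF w, where D = D])
        fix u :: 'l assume u: "u \<noteq> 0"
        let ?A = "(\<lambda>x. A x + u * D x)(?w := inverse u)"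
        have "rank_le {i..m} (?J j) (r - depth i j) ?A" if "q \<le> j" for j
        proof (cases "j = q")
          case True
          have "rank_le (insert i ?I) (insert q (?J (Suc q))) (Suc \<rho>') ?A"
            by (rule rank_le_pivot[OF \<rho>'(2)]) (use u in \<open>auto simp: D_def\<close>)
          then show ?thesis unfolding True rows cols \<rho>'(1)[symmetric] \<rho>_def .
        next
          case False
          with that have j: "Suc q \<le> j" by simp
          have "rank_le {i..m} (?J j) (r - depth i j)
              (\<lambda>(a, b). A (a, b) + (if a = i then 0 else u * A (a, q)) * A (i, b))"
            by (rule rank_le_add_row[OF A1[OF j]]) (use i in simp)
          then show ?thesis
            by (rule rank_le_cong) (use j in \<open>auto simp: D_def\<close>)
        qed
        moreover have "rank_le ?I (?J j) (r - depth (Suc i) j) ?A" if j: "1 \<le> j" "j \<le> q" for j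
        proof -
          have "rank_le ?I (?J j) (r - depth (Suc i) j)
              (\<lambda>(a, b). A (a, b) + A (a, q) * (if q < b then u * A (i, b) else 0))"
            by (rule rank_le_add_col[OF A2]) (use j qT in auto)
          then show ?thesis
            by (rule rank_le_cong) (auto simp: D_def)
        qed
        ultimately have "rank_conditions i q ?A" by (simp add: rank_conditions_def)
        from IH[OF this] show "front {x \<in> X. x < ?w} ?A = 0" by (simp add: before_def)
      qed
    next
      case full: False
      have notin: "?w \<notin> keys (lm f)"
      proof
        assume "?w \<in> keys (lm f)"
        from depth_step[OF this qT] depth_le[of "Suc i" "Suc q"]
        have \<rho>: "\<rho> = Suc (r - Suc (depth i q))" and
          le: "r - depth (Suc i) (Suc q) \<le> r - Suc (depth i q)"
          by (auto simp: \<rho>_def)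
        have "rank_le ?I (?J (Suc q)) (r - depth (Suc i) (Suc q)) A" by (rule A2) simp_all
        from rank_le_mono[OF this le] \<rho> full show False by blast
      qed
      have fin: "finite (?J (Suc q))" by (rule finite_subset[of _ "{1..n}"]) (use T_range in auto)
      have row: "rank_le (insert i ?I) (?J (Suc q)) \<rho> A"
        unfolding rows[symmetric]
        by (rule rank_le_mono[OF A1[OF order_refl]]) (use depth_mono[of i i q "Suc q"] in \<open>simp add: \<rho>_def\<close>)
      have "rank_le ?I (?J q) (r - depth (Suc i) q) A" using q(1) by (intro A2) simp_all
      then have col: "rank_le ?I (insert q (?J (Suc q))) \<rho> A"
        unfolding cols[symmetric]
        by (rule rank_le_mono) (use depth_mono[of i "Suc i" q q] in \<open>simp add: \<rho>_def\<close>)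
      obtain x where x: "rank_le (insert i ?I) (insert q (?J (Suc q))) \<rho> (A(?w := x))"
        by (rule rank_le_fill_corner[OF fin _ _ row col]) (use full in auto)
      let ?A = "A(?w := x)"
      have "rank_le {i..m} (?J j) (r - depth i j) ?A" if "q \<le> j" for j
      proof (cases "j = q")
        case True
        then show ?thesis using x unfolding rows cols True \<rho>_def by simp
      next
        case False
        with that have "Suc q \<le> j" by simp
        from A1[OF this] show ?thesis
          by (rule rank_le_cong) (use \<open>Suc q \<le> j\<close> in auto)
      qed
      moreover have "rank_le ?I (?J j) (r - depth (Suc i) j) ?A" if j: "1 \<le> j" "j \<le> q" for j
        by (rule rank_le_cong[OF A2]) (use j in auto)
      ultimately have "rank_conditions i q ?A" by (simp add: rank_conditions_def)
      then have "front (before i q) ?A = 0" by (rule IH)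
      moreover have "front (before i q) ?A = front (before i (Suc q)) A"
      proof -
        let ?U = "{x \<in> X. x < ?w}"
        have t0: "lookup t ?w = 0" if "t \<in> agreeing ?U" for t
          using exponent_le[OF that] notin by (simp add: in_keys_iff)
        then have "agreeing (insert ?w ?U) = agreeing ?U"
          using notin by (auto simp: agreeing_insert in_keys_iff)
        moreover have "(\<Prod>y \<in> X - ?U. ?A y ^ lookup t y) = (\<Prod>y \<in> X - insert ?w ?U. A y ^ lookup t y)"
          if "t \<in> agreeing ?U" for t
          using t0[OF that] by (intro prod.mono_neutral_cong_right) auto
        ultimately show ?thesis
          unfolding next_front by (simp add: front_def before_def)
      qed
      ultimately show ?thesis by simp
    qed
  qed
qed

text \<open>
  At the end of a row the bounds on the blocks below it become the bounds for the next row.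
\<close>

lemma front_zero:
  assumes "1 \<le> i" "i \<le> Suc m" "rank_conditions i 1 A"
  shows "front (before i 1) A = 0"
  using assms
proof (induction i arbitrary: A rule: dec_induct)
  case base
  have "before 1 1 = {}" by (auto simp: before_def)
  moreover have "agreeing {} = keys f" by (simp add: agreeing_def)
  moreover have "mon_value A t = (\<Prod>x \<in> X. A x ^ lookup t x)" if "t \<in> keys f" for t
    by (rule mon_value_superset) (use that f_carrier in \<open>auto simp: KX_carrier_iff\<close>)
  ultimately have "front (before 1 1) A = ev h A f"
    by (simp add: front_def ev_def)
  moreover have "rank_le {1..m} {b \<in> T. 1 \<le> b} (r - depth 1 1) A"
    using base by (simp add: rank_conditions_def)
  then have "rank_le {1..m} {b \<in> T. 1 \<le> b} r A" by (rule rank_le_mono) simp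
  then have "rank_le {1..m} T r A"
    by (rule rank_le_subset) (use T_range in auto)
  ultimately show ?case using vanishes by simp
next
  case (step i)
  have "front (before i q) A = 0" if "1 \<le> q" "q \<le> Suc n" "rank_conditions i q A" for q A
    using that
  proof (induction q arbitrary: A rule: dec_induct)
    case base
    then show ?case using step by simp
  next
    case (step q)
    then show ?case using front_step[of i q A] \<open>1 \<le> i\<close> \<open>Suc i \<le> Suc m\<close> by simp
  qed
  note row = this[of "Suc n"]
  have "rank_conditions i (Suc n) A"
    unfolding rank_conditions_def
  proof (intro conjI allI impI)
    fix j assume "Suc n \<le> j"
    then have e: "{b \<in> T. j \<le> b} = {}" using T_range by fastforce
    show "rank_le {i..m} {b \<in> T. j \<le> b} (r - depth i j) A"
      unfolding e by (rule rank_le_no_columns)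
  next
    fix j :: nat assume "1 \<le> j"
    moreover have "{i<..m} = {Suc i..m}" by auto
    ultimately show "rank_le {i<..m} {b \<in> T. j \<le> b} (r - depth (Suc i) j) A"
      using step.prems by (simp add: rank_conditions_def)
  qed
  moreover have "before (Suc i) 1 = before i (Suc n)" by (auto simp: before_def)
  ultimately show ?case using row by simp
qed

lemma contradiction: False
proof -
  have "rank_conditions (Suc m) 1 (\<lambda>_. 0)"
    by (simp add: rank_conditions_def rank_le_zero)
  then have "front (before (Suc m) 1) (\<lambda>_. 0) = 0" by (intro front_zero) simp_all
  moreover have "before (Suc m) 1 = X" by (auto simp: before_def)
  moreover have "agreeing X = {lm f}"
  proof -
    have "t = lm f" if "t \<in> agreeing X" for t
    proof (rule poly_mapping_eqI)
      fix x
      have t: "keys t \<subseteq> X" "\<forall>x \<in> X. lookup t x = lookup (lm f) x"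
        using that f_carrier unfolding agreeing_def KX_carrier_iff by blast+
      show "lookup t x = lookup (lm f) x"
      proof (cases "x \<in> X")
        case False
        then have "x \<notin> keys t" "x \<notin> keys (lm f)"
          using t(1) lm_keys_subset[OF f_carrier f_nonzero] by blast+
        then show ?thesis by (simp add: in_keys_iff)
      qed (use t(2) in blast)
    qed
    moreover have "lm f \<in> agreeing X" using lm_in_keys[OF f_nonzero] by (simp add: agreeing_def)
    ultimately show ?thesis by blast
  qed
  ultimately have "h (lookup f (lm f)) = 0" by (simp add: front_def)
  moreover have "lookup f (lm f) \<noteq> 0" using lm_in_keys[OF f_nonzero] by (simp add: in_keys_iff)
  then have "h (lookup f (lm f)) * h (inverse (lookup f (lm f))) = 1"
    by (simp add: hom_mult[symmetric])
  ultimately show False by simp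
qed

end

section \<open>Hypergraph ideals of cliques\<close>

text \<open>
  The coefficient field may be finite; rational functions in one variable are an infinite extension.
\<close>

lemma exists_infinite_extension:
  "\<exists>h :: 'k::field \<Rightarrow> 'k poly fract. comm_ring_hom h \<and> infinite (UNIV :: 'k poly fract set)"
proof (intro exI conjI)
  let ?h = "\<lambda>c :: 'k. Fract [:c:] 1"
  show "comm_ring_hom ?h"
    by unfold_locales (simp_all add: Zero_fract_def One_fract_def pCons_one mult.commute)
  have "inj (\<lambda>i. Fract (monom (1 :: 'k) i) 1)"
    by (rule injI) (simp add: eq_fract monom_eq_iff')
  then show "infinite (UNIV :: 'k poly fract set)"
    using range_inj_infinite infinite_super[OF subset_UNIV] by blast
qed

text \<open>
  The polynomials in the ideal vanish at the matrices whose columns in \<open>T\<close> have rank below \<open>k\<close>, so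
  their leading monomials contain chains of \<open>k\<close> variables with columns in \<open>T\<close>, and these are the
  diagonals of the generators. For \<open>k = 0\<close> the empty chain belongs to the generator 1.
\<close>

lemma lm_covers_clique:
  fixes m n k :: nat and T :: "nat set"
  assumes T: "T \<subseteq> {1..n}"
  defines "G \<equiv> generating_minors m {B. B \<subseteq> T \<and> card B = k} :: 'k::field mpoly set"
  shows "lm_covers ({1..m} \<times> {1..n}) G (Idl\<^bsub>KX m n\<^esub> G)"
proof -
  have GI: "minor A B \<in> G" if "A \<subseteq> {1..m}" "B \<subseteq> T" "card A = k" "card B = k" for A B
    unfolding G_def generating_minors_def mem_Collect_eq
    by (rule exI[of _ A], rule exI[of _ B]) (use that in simp)
  have finT: "finite T" using T by (rule finite_subset) simp
  have "hypergraph n {B. B \<subseteq> T \<and> card B = k}" using T by (auto simp: hypergraph_def)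
  then have GK: "G \<subseteq> carrier (KX m n)" unfolding G_def by (rule generating_minors_in_KX)
  show ?thesis
    unfolding lm_covers_def
  proof (intro ballI impI)
    fix f assume f: "f \<in> Idl\<^bsub>KX m n\<^esub> G" and f0: "f \<noteq> 0"
    have "ideal (Idl\<^bsub>KX m n\<^esub> G) (KX m n)"
      by (rule ring.genideal_ideal[OF cring.axioms(1)[OF cring_KX] GK])
    then have fK: "f \<in> carrier (KX m n)" using ideal_KX_closed(1) f by blast
    have fX: "keys (lm f) \<subseteq> {1..m} \<times> {1..n}" by (rule lm_keys_subset[OF fK f0])
    show "\<exists>g \<in> G. \<exists>a. keys a \<subseteq> {1..m} \<times> {1..n} \<and> lm f = a + lm g"
    proof (rule ccontr)
      assume none: "\<not> ?thesis"
      have short: "card C < k" if C: "C \<subseteq> keys (lm f)" "snd ` C \<subseteq> T" "chain C" for C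
      proof (rule ccontr)
        assume "\<not> card C < k"
        then obtain C' where C': "C' \<subseteq> C" "card C' = k" "finite C'"
          using obtain_subset_with_card_n[of k C] by (metis not_less)
        let ?g = "minor (fst ` C') (snd ` C') :: 'k mpoly"
        note diag = chain_is_diagonal[OF C'(3) chain_subset[OF C(3) C'(1)]]
        have rows: "fst ` C' \<subseteq> {1..m}" using C'(1) C(1) fX by fastforce
        have g: "?g \<in> G" by (rule GI) (use rows C' C(2) diag in auto)
        have lm: "lookup (lm ?g) x = (if x \<in> C' then 1 else 0)" for x
          using lm_minor(1)[of "fst ` C'" "snd ` C'" x, where ?'k = 'k] diag C'(3) by simp
        define a where "a = lm f - lm ?g"
        have "lookup (lm ?g) x \<le> lookup (lm f) x" for x
        proof (cases "x \<in> C'")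
          case True
          then have "x \<in> keys (lm f)" using C'(1) C(1) by blast
          then show ?thesis unfolding lm in_keys_iff by simp
        qed (simp add: lm)
        then have a: "lm f = a + lm ?g"
          by (intro poly_mapping_eqI) (simp add: a_def lookup_add minus_poly_mapping.rep_eq)
        then have "keys a \<subseteq> keys (lm f)" by (auto simp: in_keys_iff lookup_add)
        with fX have "keys a \<subseteq> {1..m} \<times> {1..n}" by (rule order_trans[rotated])
        with a g none show False by blast
      qed
      from short[of "{}"] obtain r where r: "k = Suc r" by (cases k) (auto simp: chain_def)
      obtain h :: "'k \<Rightarrow> 'k poly fract" where h: "comm_ring_hom h" "infinite (UNIV :: 'k poly fract set)"
        using exists_infinite_extension by blast
      have "vanishing_on_low_rank h f m n r T"
      proof (rule vanishing_on_low_rank.intro)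
        show "card C \<le> r" if "C \<subseteq> keys (lm f)" "snd ` C \<subseteq> T" "chain C" for C
          using short[OF that] r by simp
        fix A :: "nat \<times> nat \<Rightarrow> 'k poly fract" assume A: "rank_le {1..m} T r A"
        interpret E: comm_ring_hom "ev h A" by (rule comm_ring_hom_ev[OF h(1)])
        have zero: "ev h A g = 0" if g: "g \<in> G" for g
        proof -
          obtain R B where RB: "g = minor R B" "R \<subseteq> {1..m}" "B \<subseteq> T" "card R = Suc r" "card B = Suc r"
            using g r unfolding G_def generating_minors_def by auto
          have "finite R" by (rule finite_subset[OF RB(2)]) simp
          moreover have "ev h A (var i j) = A (i, j)" for i j
          proof -
            interpret h: comm_ring_hom h by (rule h(1))
            show ?thesis by (simp add: ev_def var_def mon_value_def)
          qed
          ultimately show ?thesis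
            unfolding RB(1)
            using minor_vanishes[OF E.comm_ring_hom_axioms _ A RB(2,3) _ finite_subset[OF RB(3) finT] RB(4,5)]
            by blast
        qed
        have "f \<in> mspan ({1..m} \<times> {1..n}) G (\<lambda>_. True)" using Idl_subset_rep[OF GK] f by blast
        then show "ev h A f = 0"
        proof (induction rule: mspan.induct)
          case (mspan_step p g a c)
          then show ?case by (simp add: E.hom_add E.hom_mult zero)
        qed (rule E.hom_zero)
      qed (use h T fK f0 in blast)+
      then show False by (rule vanishing_on_low_rank.contradiction)
    qed
  qed
qed

section \<open>Closed hypergraphs\<close>

text \<open>
  A variable in both monomials is a common divisor that is not a unit.
\<close>

lemma relatively_prime_monomials:
  assumes rp: "relatively_prime (KX m n) (single s 1 :: 'k::field mpoly) (single t 1)"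
    and st: "keys s \<subseteq> {1..m} \<times> {1..n}" "keys t \<subseteq> {1..m} \<times> {1..n}"
  shows "keys s \<inter> keys t = {}"
proof (rule ccontr)
  assume "keys s \<inter> keys t \<noteq> {}"
  then obtain x where x: "x \<in> keys s" "x \<in> keys t" by blast
  let ?e = "single x (1 :: nat)"
  let ?d = "single ?e 1 :: 'k mpoly"
  have dK: "?d \<in> carrier (KX m n)" using x(1) st(1) by (auto simp: KX_carrier_iff)
  have divides: "?d divides\<^bsub>KX m n\<^esub> single u 1" if u: "x \<in> keys u" "keys u \<subseteq> {1..m} \<times> {1..n}" for u
  proof (rule dividesI)
    have sub: "keys (u - ?e) \<subseteq> keys u"
      by (auto simp: in_keys_iff minus_poly_mapping.rep_eq)
    then show "single (u - ?e) 1 \<in> carrier (KX m n)"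
      using u(2) by (auto simp: KX_carrier_iff)
    have "u = ?e + (u - ?e)"
      by (rule poly_mapping_eqI)
         (use u(1) in \<open>auto simp: lookup_add minus_poly_mapping.rep_eq lookup_single when_def in_keys_iff\<close>)
    then show "single u 1 = ?d \<otimes>\<^bsub>KX m n\<^esub> single (u - ?e) 1"
      by (simp add: mult_single)
  qed
  have "?d \<in> Units (KX m n)"
    using rp dK divides[OF x(1) st(1)] divides[OF x(2) st(2)] unfolding relatively_prime_def by blast
  then obtain y :: "'k mpoly" where "?d * y = 1" by (auto simp: Units_def)
  then have "keys (?d * y) = {0}" by simp
  then have "0 \<in> (+) ?e ` keys y" by (simp add: keys_single_times)
  then obtain u where "0 = ?e + u" by blast
  then have "lookup (0 :: monom) x = lookup (?e + u) x" by simp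
  then show False by (simp add: lookup_add)
qed

text \<open>
  The difference lies in the ideal and its leading monomial is smaller, as the leading terms cancel;
  dividing it by \<open>G\<close> gives the representation.
\<close>

lemma clique_pair:
  fixes G :: "'k::field mpoly set"
  defines "X m n \<equiv> {1..m::nat} \<times> {1..n::nat}"
  assumes G: "G \<subseteq> carrier (KX m n)" "\<And>g. g \<in> G \<Longrightarrow> lookup g (lm g) = 1"
    and cov: "lm_covers (X m n) G (Idl\<^bsub>KX m n\<^esub> G)"
    and gh: "g \<in> G" "h \<in> G" and ab: "keys a \<subseteq> X m n" "keys b \<subseteq> X m n" "a + lm g = b + lm h"
  shows "single a 1 * g - single b 1 * h \<in> mspan (X m n) G (\<lambda>s. s < a + lm g)"
proof (cases "single a 1 * g - single b 1 * h = 0")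
  case True
  show ?thesis unfolding True by (rule mspan_zero)
next
  case False
  let ?f = "single a 1 * g - single b 1 * h"
  interpret cring "KX m n :: 'k mpoly ring" by (rule cring_KX)
  have I: "ideal (Idl\<^bsub>KX m n\<^esub> G) (KX m n)" by (rule genideal_ideal[OF G(1)])
  note Ic = ideal_KX_closed[OF I]
  have sub: "G \<subseteq> Idl\<^bsub>KX m n\<^esub> G" by (rule genideal_self[OF G(1)])
  have "?f \<in> Idl\<^bsub>KX m n\<^esub> G"
    by (intro Ic(5) Ic(4)) (use gh sub ab in \<open>auto simp: KX_carrier_iff X_def\<close>)
  moreover have "0 \<notin> G" using G(2) by force
  ultimately have f: "?f \<in> mspan (X m n) G (\<lambda>s. s \<le> lm ?f)"
    using division[OF I sub] cov unfolding X_def by blast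
  have "lookup ?f (a + lm g) = 0"
    using lookup_single_times[of a 1 g "lm g"] lookup_single_times[of b 1 h "lm h"] G(2) gh ab(3)
    by (simp add: lookup_minus)
  then have "lm ?f \<noteq> a + lm g" using lm_in_keys[OF False] by (auto simp: in_keys_iff)
  moreover have "lm ?f \<le> a + lm g"
  proof -
    have "lm ?f \<in> keys (single a 1 * g) \<or> lm ?f \<in> keys (single b 1 * h)"
      using lm_in_keys[OF False] keys_diff[of "single a 1 * g" "single b 1 * h"] by blast
    then show ?thesis
    proof
      assume "lm ?f \<in> keys (single a 1 * g)"
      then obtain v where "v \<in> keys g" "lm ?f = a + v" by (auto simp: keys_single_times)
      then show ?thesis using add_left_mono[OF lm_ge] by metis
    next
      assume "lm ?f \<in> keys (single b 1 * h)"
      then obtain v where "v \<in> keys h" "lm ?f = b + v" by (auto simp: keys_single_times)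
      then show ?thesis unfolding ab(3) using add_left_mono[OF lm_ge] by metis
    qed
  qed
  ultimately have lt: "lm ?f < a + lm g" by (rule le_neq_trans[rotated])
  show ?thesis
    by (rule mspan_mono[OF f order_refl]) (rule le_less_trans[OF _ lt])
qed

theorem proposition2p6:
  fixes m n :: nat and \<Delta> :: "nat set set"
  assumes "2 < m" and "m \<le> n"
    and "hypergraph n \<Delta>"
    and "closed_hypergraph TYPE('k::field) m n \<Delta>"
  shows "groebner_basis m n (generating_minors m \<Delta>) (hypergraph_ideal m n \<Delta> :: 'k mpoly set) \<and>
    radical (KX m n) (hypergraph_ideal m n \<Delta> :: 'k mpoly set) = hypergraph_ideal m n \<Delta>"
proof -
  let ?X = "{1..m} \<times> {1..n}"
  let ?G = "generating_minors m :: nat set set \<Rightarrow> 'k mpoly set"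
  let ?I = "hypergraph_ideal m n \<Delta> :: 'k mpoly set"
  have GK: "?G \<Delta> \<subseteq> carrier (KX m n)" by (rule generating_minors_in_KX[OF assms(3)])
  have I: "ideal ?I (KX m n)" by (rule hypergraph_ideal_is_ideal[OF assms(3)])
  have GI: "?G \<Delta> \<subseteq> ?I"
    unfolding hypergraph_ideal_def
    by (rule ring.genideal_self[OF cring.axioms(1)[OF cring_KX] GK])
  have minor: "\<exists>A B. g = minor A B \<and> finite A \<and> finite B \<and> card A = card B" if g: "g \<in> ?G \<Delta>" for g
  proof -
    obtain A B where AB: "g = minor A B" "B \<in> \<Delta>" "A \<subseteq> {1..m}" "card A = card B"
      using g unfolding generating_minors_def by blast
    have "finite A" by (rule finite_subset[OF AB(3)]) simp
    moreover have "finite B"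
      by (rule finite_subset[of _ "{1..n}"]) (use AB(2) assms(3) in \<open>auto simp: hypergraph_def\<close>)
    ultimately show ?thesis using AB by blast
  qed
  have monic: "lookup g (lm g) = 1" if "g \<in> ?G \<Delta>" for g
    using minor[OF that] lm_minor(2) by blast
  have sqf: "lookup (lm g) x \<le> 1" if g: "g \<in> ?G \<Delta>" for g x
  proof -
    obtain A B where "g = minor A B" "finite A" "finite B" "card A = card B"
      using minor[OF g] by blast
    then show ?thesis using lm_minor(1)[of A B x, where ?'k = 'k] by simp
  qed
  have zero: "0 \<notin> ?G \<Delta>" using monic by force
  have "\<Delta> \<subseteq> Pow {1..n}" using assms(3) by (simp add: hypergraph_def)
  then have "finite \<Delta>" by (rule finite_subset) simp
  moreover have "?G \<Delta> \<subseteq> (\<lambda>(A, B). minor A B) ` (Pow {1..m} \<times> \<Delta>)"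
    by (auto simp: generating_minors_def)
  ultimately have fin: "finite (?G \<Delta>)" by (auto elim: finite_subset)
  have clique_sub: "?G C \<subseteq> ?G \<Delta>" if "C \<in> clique_decomposition n \<Delta>" for C
    using Union_clique_decomposition[OF assms(3)] that unfolding generating_minors_def by blast
  have clique_mem: "\<exists>C \<in> clique_decomposition n \<Delta>. g \<in> ?G C" if "g \<in> ?G \<Delta>" for g
    using that Union_clique_decomposition[OF assms(3)] unfolding generating_minors_def by blast
  have clique_cov: "lm_covers ?X (?G C) (Idl\<^bsub>KX m n\<^esub> (?G C))"
    if C: "C \<in> clique_decomposition n \<Delta>" for C
  proof -
    obtain k T where "T \<subseteq> {1..n}" "C = {T'. T' \<subseteq> T \<and> card T' = k}"
      using C unfolding clique_decomposition_def is_maximal_clique_def is_clique_def by blast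
    then show ?thesis using lm_covers_clique[of T n m k, where ?'k = 'k] by simp
  qed
  have "lm_covers ?X (?G \<Delta>) (Idl\<^bsub>KX m n\<^esub> (?G \<Delta>))"
  proof (rule lm_covers_of_pairs[OF GK monic])
    fix g h a b
    assume gh: "g \<in> ?G \<Delta>" "h \<in> ?G \<Delta>" and ab: "keys a \<subseteq> ?X" "keys b \<subseteq> ?X" "a + lm g = b + lm h"
    obtain C D where C: "C \<in> clique_decomposition n \<Delta>" "g \<in> ?G C"
      and D: "D \<in> clique_decomposition n \<Delta>" "h \<in> ?G D"
      using clique_mem gh by blast
    show "single a 1 * g - single b 1 * h \<in> mspan ?X (?G \<Delta>) (\<lambda>s. s < a + lm g)"
    proof (cases "C = D")
      case True
      have sub: "?G C \<subseteq> ?G \<Delta>" by (rule clique_sub[OF C(1)])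
      have "single a 1 * g - single b 1 * h \<in> mspan ?X (?G C) (\<lambda>s. s < a + lm g)"
        by (rule clique_pair[OF _ _ clique_cov[OF C(1)] C(2) _ ab])
           (use sub GK monic D(2) True in blast)+
      then show ?thesis by (rule mspan_mono[OF _ sub])
    next
      case False
      have ini: "initial_term p = single (lm p) 1" if "p \<in> ?G \<Delta>" for p
        using monic[OF that] by (simp add: initial_term_def lm_def Let_def)
      have lmX: "keys (lm p) \<subseteq> ?X" if "p \<in> ?G \<Delta>" for p
        using that GK zero by (intro lm_keys_subset) auto
      have keysX: "keys t \<subseteq> ?X" if "p \<in> ?G \<Delta>" "t \<in> keys p" for p t
      proof -
        have "p \<in> carrier (KX m n)" using that(1) GK by blast
        then show ?thesis using that(2) unfolding KX_carrier_iff by blast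
      qed
      have "relatively_prime (KX m n) (initial_term g) (initial_term h)"
        using assms(4) C D False unfolding closed_hypergraph_def by blast
      then have "keys (lm g) \<inter> keys (lm h) = {}"
        unfolding ini[OF gh(1)] ini[OF gh(2)]
        by (rule relatively_prime_monomials) (rule lmX[OF gh(1)], rule lmX[OF gh(2)])
      then show ?thesis
        by (intro coprime_pair gh monic ab keysX[OF gh(1)] keysX[OF gh(2)])
    qed
  qed
  then have cov: "lm_covers ?X (?G \<Delta>) ?I" by (simp only: hypergraph_ideal_def)
  show ?thesis
    using lm_covers_imp_groebner_basis[OF I fin GI zero cov]
      squarefree_lm_imp_radical[OF I GI zero sqf cov] by blast
qed

end
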